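(* Suppose that for all $n<\omega$ there is a normal ideal $I$ on $\omega_{n+1}$ such that $\mathcal P(\omega_{n+1})/I\cong\mathcal B(\mathrm{Col}(\omega_n,\omega_{n+1}))$. Then for all $n\le m<\omega$, $\chi(\mathsf{EH}(\omega_m,\omega_n))=\omega_{n+1}$.
   Context: For ordinals $\kappa,\lambda$, $\mathrm{Col}(\kappa,\lambda)$ is the poset of partial functions from $\kappa$ to $\lambda$ defined at fewer than $\kappa$ many points, ordered by reverse inclusion. $\mathcal B(\mathbb P)$ is the Boolean completion of $\mathbb P$. A graph is a pair $G=\langle V_G,E_G\rangle$ with $E_G\subseteq[V_G]^2$. A vertex coloring of $G$ is a function $c:V_G\to\kappa$, $\kappa$ a cardinal, with $c(x)\ne c(y)$ whenever $\{x,y\}\in E_G$; the chromatic number $\chi(G)$ is the least cardinal $\kappa$ for which there is a vertex coloring $c:V_G\to\kappa$. The Erdős–Hajnal graph $\mathsf{EH}(\kappa,\lambda)$ has as vertices all functions $f:\kappa\to\lambda$, with $f,g$ connected by an edge when $|\{\alpha<\kappa: f(\alpha)=g(\alpha)\}|<\kappa$. *)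

theory Defs
  imports "HOL-Analysis.Abstract_Topology" "HOL-Library.FuncSet"
begin

unbundle cardinal_syntax

text \<open>
  Ordinals are the elements of a well-ordered type, an element \<open>\<kappa>\<close> being identified with its set
  \<open>{..<\<kappa>}\<close> of predecessors. HOL does not prove that a single type contains all of the cardinals
  \<open>\<omega>\<^sub>n\<close>, so their existence has to be assumed wherever they are used; without it the
  \<open>LEAST\<close> in the following recursion is meaningless. The assumption holds for every type that has
  at least \<open>\<aleph>\<^sub>\<omega>\<close> elements.
\<close>

primrec omega :: "nat \<Rightarrow> 'a::wellorder" where
  "omega 0 = (LEAST \<kappa>. infinite {..<\<kappa>})"
| "omega (Suc n) = (LEAST \<kappa>. |{..<omega n :: 'a}| <o |{..<\<kappa>}| )"

definition omegas_exist :: "'a::wellorder itself \<Rightarrow> bool" where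
  "omegas_exist _ \<longleftrightarrow>
     (\<exists>\<kappa>::'a. infinite {..<\<kappa>}) \<and> (\<forall>n. \<exists>\<kappa>::'a. |{..<omega n :: 'a}| <o |{..<\<kappa>}| )"

lemma card_of_segment:
  fixes x :: "'a::wellorder"
  assumes "Card_order s" "s <o |{..<x}|"
  shows "\<exists>a<x. |{..<a}| =o s"
proof -
  define r where "r = {(a, b). a \<le> b \<and> b < x}"
  have F: "Field r = {..<x}"
    by (auto simp: r_def Field_def)
  have wo: "Well_order r"
  proof -
    have "Refl r" "trans r" "antisym r" "Total r"
      by (auto simp: r_def refl_on_def Field_def trans_def antisym_def total_on_def)
    moreover have "wf (r - Id)"
      by (rule wf_subset[OF wf]) (auto simp: r_def)
    moreover have "r \<subseteq> Field r \<times> Field r"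
      by (auto simp: Field_def)
    ultimately show ?thesis
      unfolding well_order_on_def linear_order_on_def partial_order_on_def preorder_on_def by blast
  qed
  have "|{..<x}| \<le>o r"
    using card_of_least wo F by metis
  then have "s <o r"
    using assms(2) ordLess_ordLeq_trans by blast
  then obtain a where a: "a \<in> Field r" "s =o Restr r (underS r a)"
    using ordLess_iff_ordIso_Restr[OF wo] assms(1) card_order_on_well_order_on by blast
  have u: "underS r a = {..<a}"
    using a(1) by (auto simp: underS_def F) (auto simp: r_def)
  have "Field (Restr r (underS r a)) = {..<a}"
    using a(1) by (auto simp: u F) (auto simp: r_def Field_def)
  then have "|Field s| =o |{..<a}|"
    using a(2) by (metis card_of_cong)
  moreover have "|Field s| =o s"
    using assms(1) by (rule card_of_Field_ordIso)
  ultimately show ?thesis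
    using a(1) F by (metis ordIso_symmetric ordIso_transitive lessThan_iff)
qed

lemma card_omega_0:
  assumes "omegas_exist TYPE('a::wellorder)"
  shows "|{..<omega 0 :: 'a}| =o natLeq"
proof -
  let ?k = "omega 0 :: 'a"
  have inf: "infinite {..<?k}"
    using assms unfolding omegas_exist_def omega.simps by (metis (mono_tags, lifting) LeastI_ex)
  then have le: "natLeq \<le>o |{..<?k}|"
    using infinite_iff_natLeq_ordLeq by blast
  have "\<not> natLeq <o |{..<?k}|"
  proof
    assume "natLeq <o |{..<?k}|"
    then obtain a where a: "a < ?k" "|{..<a}| =o natLeq"
      using card_of_segment natLeq_Card_order by blast
    then have "infinite {..<a}"
      by (meson infinite_iff_natLeq_ordLeq ordIso_iff_ordLeq)
    with a(1) show False
      using not_less_Least by auto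
  qed
  with le show ?thesis
    using ordIso_iff_ordLeq ordLeq_iff_ordLess_or_ordIso ordIso_symmetric by blast
qed

lemma card_omega_Suc:
  assumes "omegas_exist TYPE('a::wellorder)"
  shows "|{..<omega (Suc n) :: 'a}| =o cardSuc |{..<omega n :: 'a}|"
proof -
  let ?k = "omega n :: 'a" and ?l = "omega (Suc n) :: 'a"
  have "|{..<?k}| <o |{..<?l}|"
    using assms unfolding omegas_exist_def omega.simps by (metis (mono_tags, lifting) LeastI_ex)
  then have le: "cardSuc |{..<?k}| \<le>o |{..<?l}|"
    by (simp add: cardSuc_least card_of_Card_order)
  have "\<not> cardSuc |{..<?k}| <o |{..<?l}|"
  proof
    assume "cardSuc |{..<?k}| <o |{..<?l}|"
    then obtain a where a: "a < ?l" "|{..<a}| =o cardSuc |{..<?k}|"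
      using card_of_segment cardSuc_Card_order card_of_Card_order by blast
    then have "|{..<?k}| <o |{..<a}|"
      by (meson cardSuc_greater card_of_Card_order ordIso_symmetric ordLess_ordIso_trans)
    with a(1) show False
      using not_less_Least by auto
  qed
  with le show ?thesis
    using ordLeq_iff_ordLess_or_ordIso ordIso_symmetric by blast
qed

definition ideal_on :: "'a::wellorder \<Rightarrow> 'a set set \<Rightarrow> bool" where
  "ideal_on \<kappa> I \<longleftrightarrow>
     I \<subseteq> Pow {..<\<kappa>} \<and> {} \<in> I \<and> {..<\<kappa>} \<notin> I \<and>
     (\<forall>A\<in>I. \<forall>B\<subseteq>A. B \<in> I) \<and> (\<forall>A\<in>I. \<forall>B\<in>I. A \<union> B \<in> I)"

text \<open>
  As usual, \<open>\<kappa>\<close>-completeness and containing all singletons are part of normality; closure under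
  diagonal unions alone does not imply that bounded sets are in the ideal.
\<close>

definition normal_ideal_on :: "'a::wellorder \<Rightarrow> 'a set set \<Rightarrow> bool" where
  "normal_ideal_on \<kappa> I \<longleftrightarrow>
     ideal_on \<kappa> I \<and>
     (\<forall>\<alpha><\<kappa>. {\<alpha>} \<in> I) \<and>
     (\<forall>F\<subseteq>I. |F| <o |{..<\<kappa>}| \<longrightarrow> \<Union>F \<in> I) \<and>
     (\<forall>A. (\<forall>\<alpha><\<kappa>. A \<alpha> \<in> I) \<longrightarrow> {\<beta>. \<beta> < \<kappa> \<and> (\<exists>\<alpha><\<beta>. \<beta> \<in> A \<alpha>)} \<in> I)"

text \<open>
  Boolean algebras are given by their partial orders, written as relations. The operations are
  determined by the order, so an isomorphism of Boolean algebras is an isomorphism of these orders.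
\<close>

definition order_isomorphic :: "'a rel \<Rightarrow> 'b rel \<Rightarrow> bool" where
  "order_isomorphic r s \<longleftrightarrow>
     (\<exists>f. bij_betw f (Field r) (Field s) \<and>
          (\<forall>a\<in>Field r. \<forall>b\<in>Field r. (a, b) \<in> r \<longleftrightarrow> (f a, f b) \<in> s))"

definition powerset_mod :: "'a set \<Rightarrow> 'a set set \<Rightarrow> 'a set set rel" where
  "powerset_mod S I =
     (let Q = Pow S // {(A, B). A \<subseteq> S \<and> B \<subseteq> S \<and> sym_diff A B \<in> I}
      in {(X, Y). X \<in> Q \<and> Y \<in> Q \<and> (\<exists>A\<in>X. \<exists>B\<in>Y. A - B \<in> I)})"

text \<open>
  The Boolean completion of a poset is the algebra of regular open sets of the topology
  whose open sets are the downward closed ones.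
\<close>

definition down_topology :: "'p set \<Rightarrow> ('p \<Rightarrow> 'p \<Rightarrow> bool) \<Rightarrow> 'p topology" where
  "down_topology P le = topology (\<lambda>U. U \<subseteq> P \<and> (\<forall>p\<in>U. \<forall>q\<in>P. le q p \<longrightarrow> q \<in> U))"

lemma openin_down_topology:
  "openin (down_topology P le) U \<longleftrightarrow> U \<subseteq> P \<and> (\<forall>p\<in>U. \<forall>q\<in>P. le q p \<longrightarrow> q \<in> U)"
proof -
  have "istopology (\<lambda>U. U \<subseteq> P \<and> (\<forall>p\<in>U. \<forall>q\<in>P. le q p \<longrightarrow> q \<in> U))"
    unfolding istopology_def by blast
  then show ?thesis
    by (simp add: down_topology_def topology_inverse')
qed

definition regular_open_in :: "'p topology \<Rightarrow> 'p set \<Rightarrow> bool" where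
  "regular_open_in X U \<longleftrightarrow> X interior_of (X closure_of U) = U"

definition boolean_completion :: "'p set \<Rightarrow> ('p \<Rightarrow> 'p \<Rightarrow> bool) \<Rightarrow> 'p set rel" where
  "boolean_completion P le =
     {(U, V). regular_open_in (down_topology P le) U \<and> regular_open_in (down_topology P le) V \<and>
              U \<subseteq> V}"

definition Col :: "'a::wellorder \<Rightarrow> 'a \<Rightarrow> ('a \<rightharpoonup> 'a) set" where
  "Col \<kappa> \<mu> = {p. dom p \<subseteq> {..<\<kappa>} \<and> ran p \<subseteq> {..<\<mu>} \<and> |dom p| <o |{..<\<kappa>}|}"

definition Col_le :: "('a \<rightharpoonup> 'a) \<Rightarrow> ('a \<rightharpoonup> 'a) \<Rightarrow> bool" where
  "Col_le p q \<longleftrightarrow> q \<subseteq>\<^sub>m p"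

type_synonym 'v graph = "'v set \<times> 'v set set"

definition vertex_coloring :: "'v graph \<Rightarrow> 'c set \<Rightarrow> ('v \<Rightarrow> 'c) \<Rightarrow> bool" where
  "vertex_coloring G K c \<longleftrightarrow>
     c \<in> fst G \<rightarrow> K \<and> (\<forall>x\<in>fst G. \<forall>y\<in>fst G. {x, y} \<in> snd G \<longrightarrow> c x \<noteq> c y)"

text \<open>
  The vertices themselves can serve as colors, so it suffices to consider cardinals on the type of
  the vertices; see \<open>chromatic_number_le_iff\<close> below.
\<close>

definition chromatic_number :: "'v graph \<Rightarrow> 'v rel" where
  "chromatic_number G =
     (SOME r. Card_order r \<and> (\<exists>c. vertex_coloring G (Field r) c) \<and>
        (\<forall>s :: 'v rel. Card_order s \<and> (\<exists>c. vertex_coloring G (Field s) c) \<longrightarrow> r \<le>o s))"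

lemma vertex_coloring_mono:
  assumes "vertex_coloring G K c" "|K| \<le>o |L|"
  shows "\<exists>c. vertex_coloring G L c"
proof -
  obtain f where f: "inj_on f K" "f ` K \<subseteq> L"
    using assms(2) card_of_ordLeq by metis
  have "f (c x) \<noteq> f (c y)" if "x \<in> fst G" "y \<in> fst G" "{x, y} \<in> snd G" for x y
  proof -
    have "c x \<in> K" "c y \<in> K" "c x \<noteq> c y"
      using assms(1) that by (auto simp: vertex_coloring_def)
    then show ?thesis
      using f(1) by (simp add: inj_on_eq_iff)
  qed
  moreover have "f (c x) \<in> L" if "x \<in> fst G" for x
    using assms(1) that f(2) by (auto simp: vertex_coloring_def)
  ultimately have "vertex_coloring G L (f \<circ> c)"
    by (simp add: vertex_coloring_def)
  then show ?thesis
    by blast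
qed

lemma chromatic_number:
  fixes G :: "'v graph"
  assumes "snd G \<subseteq> {e. e \<subseteq> fst G \<and> card e = 2}"
  shows "Card_order (chromatic_number G)"
    and "\<exists>c. vertex_coloring G (Field (chromatic_number G)) c"
    and "Card_order (s :: 'v rel) \<Longrightarrow> vertex_coloring G (Field s) c \<Longrightarrow> chromatic_number G \<le>o s"
proof -
  let ?R = "{r :: 'v rel. Card_order r \<and> (\<exists>c. vertex_coloring G (Field r) c)}"
  have "vertex_coloring G (Field |fst G| ) id"
    using assms unfolding vertex_coloring_def Field_card_of by auto
  then have "|fst G| \<in> ?R"
    using card_of_Card_order by blast
  then have "\<exists>r\<in>?R. \<forall>s\<in>?R. r \<le>o s"
    using exists_minim_Well_order[of ?R] card_order_on_well_order_on by blast
  then have "\<exists>r :: 'v rel. Card_order r \<and> (\<exists>c. vertex_coloring G (Field r) c) \<and>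
        (\<forall>s :: 'v rel. Card_order s \<and> (\<exists>c. vertex_coloring G (Field s) c) \<longrightarrow> r \<le>o s)"
    by simp
  from someI_ex[OF this] show "Card_order (chromatic_number G)"
    and "\<exists>c. vertex_coloring G (Field (chromatic_number G)) c"
    and "Card_order (s :: 'v rel) \<Longrightarrow> vertex_coloring G (Field s) c \<Longrightarrow> chromatic_number G \<le>o s"
    unfolding chromatic_number_def by blast+
qed

lemma chromatic_number_le_iff:
  fixes G :: "'v graph" and s :: "'c rel"
  assumes "snd G \<subseteq> {e. e \<subseteq> fst G \<and> card e = 2}" "Card_order s"
  shows "chromatic_number G \<le>o s \<longleftrightarrow> (\<exists>c. vertex_coloring G (Field s) c)"
proof
  assume "chromatic_number G \<le>o s"
  then show "\<exists>c. vertex_coloring G (Field s) c"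
    using chromatic_number(2)[OF assms(1)] vertex_coloring_mono card_of_mono2 by blast
next
  assume "\<exists>c. vertex_coloring G (Field s) c"
  then obtain c where c: "vertex_coloring G (Field s) c"
    by blast
  have "vertex_coloring G (c ` fst G) c"
    using c by (auto simp: vertex_coloring_def)
  moreover have "\<exists>B\<subseteq>fst G. |c ` fst G| =o |B|"
  proof -
    obtain g where "inj_on g (c ` fst G)" "g ` c ` fst G \<subseteq> fst G"
      using card_of_image[of c "fst G"] unfolding card_of_ordLeq[symmetric] by blast
    then show ?thesis
      by (metis card_of_ordIsoI inj_on_imp_bij_betw)
  qed
  then obtain B where B: "B \<subseteq> fst G" "|c ` fst G| =o |B|"
    by blast
  moreover have "|c ` fst G| \<le>o |B|"
    using B(2) by (rule ordIso_imp_ordLeq)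
  ultimately obtain d where "vertex_coloring G (Field |B| ) d"
    using vertex_coloring_mono unfolding Field_card_of by blast
  then have "chromatic_number G \<le>o |B|"
    using chromatic_number(3)[OF assms(1)] card_of_Card_order by blast
  also have "|B| \<le>o |c ` fst G|"
    using B(2) ordIso_symmetric ordIso_imp_ordLeq by blast
  also have "|c ` fst G| \<le>o |Field s|"
    using c by (auto simp: vertex_coloring_def intro!: card_of_mono1)
  also have "|Field s| \<le>o s"
    using assms(2) card_of_Field_ordIso ordIso_imp_ordLeq by blast
  finally (ordLeq_transitive) show "chromatic_number G \<le>o s" .
qed

text \<open>Functions from \<open>\<kappa>\<close> to \<open>\<mu>\<close> are extensional, i.e. constantly \<open>undefined\<close> off \<open>{..<\<kappa>}\<close>.\<close>

definition EH :: "'a::wellorder \<Rightarrow> 'a \<Rightarrow> ('a \<Rightarrow> 'a) graph" where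
  "EH \<kappa> \<mu> =
     (let V = {..<\<kappa>} \<rightarrow>\<^sub>E {..<\<mu>}
      in (V, {{f, g} | f g. f \<in> V \<and> g \<in> V \<and> f \<noteq> g \<and>
                            |{\<alpha>. \<alpha> < \<kappa> \<and> f \<alpha> = g \<alpha>}| <o |{..<\<kappa>}| }))"

lemma EH_edges: "snd (EH \<kappa> \<mu>) \<subseteq> {e. e \<subseteq> fst (EH \<kappa> \<mu>) \<and> card e = 2}"
  unfolding EH_def Let_def by (force simp: card_2_iff)

end

theory Submission
  imports Defs
begin

text \<open>
  Every ideal of the hypothesis comes with functions \<open>g\<^sub>\<gamma>\<close> (\<open>\<gamma> < \<omega>\<^sub>n\<^sub>+\<^sub>1\<close>) from \<open>\<omega>\<^sub>n\<close> to \<open>\<omega>\<^sub>n\<^sub>+\<^sub>1\<close> that represent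
  the generic collapse in the generic ultrapower: the sets \<open>{\<gamma>. p \<subseteq> g\<^sub>\<gamma>}\<close> are positive and dense
  among the positive sets. As the collapse of \<open>\<omega>\<^sub>n\<^sub>+\<^sub>2\<close> to \<open>\<omega>\<^sub>n\<^sub>+\<^sub>1\<close> adds no subsets of \<open>\<omega>\<^sub>n\<close>, a family of
  \<open>\<omega>\<^sub>n\<^sub>+\<^sub>2\<close> distinct subsets of \<open>\<omega>\<^sub>n\<close> would be constant on a positive set; hence \<open>2\<close> to the power \<open>\<omega>\<^sub>n\<close>
  is \<open>\<omega>\<^sub>n\<^sub>+\<^sub>1\<close>.

  Lower bound. If \<open>EH(\<omega>\<^sub>m, \<omega>\<^sub>n)\<close> is \<open>\<omega>\<^sub>n\<close>-colorable, then \<open>EH(\<omega>\<^sub>m, \<omega>\<^sub>n\<^sub>+\<^sub>1)\<close> is \<open>\<omega>\<^sub>n\<^sub>+\<^sub>1\<close>-colorable, by the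
  line digraph argument and the value of \<open>2\<close> to the power \<open>\<omega>\<^sub>n\<close>. Repeating this one arrives at
  \<open>EH(\<omega>\<^sub>m, \<omega>\<^sub>m)\<close>, where a diagonalization forbids \<open>\<omega>\<^sub>m\<close> colors.

  Upper bound. For \<open>m = n\<close> there are only \<open>\<omega>\<^sub>n\<^sub>+\<^sub>1\<close> vertices. For \<open>m = n + 1\<close> a function is constant on a set from a dense family of \<open>\<omega>\<^sub>n\<^sub>+\<^sub>1\<close> positive
  sets, and that set with the value is its color. To pass from \<open>\<omega>\<^sub>m\<close> to \<open>\<omega>\<^sub>m\<^sub>+\<^sub>1\<close>, one turns functions on
  \<open>\<omega>\<^sub>m\<^sub>+\<^sub>1\<close> into functions on \<open>\<omega>\<^sub>m\<close> so that agreement on a positive set is reflected. This needs a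
  descending family of sequences \<open>(u \<alpha>)\<close>, \<open>\<alpha> < \<omega>\<^sub>m\<close>, of collapsing conditions that enters the
  \<open>\<omega>\<^sub>m\<close>-th power of each dense subset of \<open>Col(\<omega>\<^sub>m, \<omega>\<^sub>m\<^sub>+\<^sub>1)\<close>. The collapse \<open>Col(\<omega>\<^sub>m\<^sub>+\<^sub>1, \<omega>\<^sub>m\<^sub>+\<^sub>2)\<close> adds such a
  family, even for the dense sets of the extension, and since the generic ultrapower by the ideal
  on \<open>\<omega>\<^sub>m\<^sub>+\<^sub>2\<close> contains it, such a family already exists.
\<close>

section \<open>Cardinals and normal ideals\<close>

declare omega.simps [simp del]

lemma finite_ordLess_infinite_set: "finite A \<Longrightarrow> infinite B \<Longrightarrow> |A| <o |B|"
  by (meson card_of_Well_order card_of_ordLeq_finite not_ordLeq_iff_ordLess)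

section \<open>The cardinals \<open>omega n\<close>: sizes and regularity\<close>

locale omegas =
  fixes T :: "'a::wellorder itself"
  assumes omegas: "omegas_exist TYPE('a)"
begin

abbreviation W :: "nat \<Rightarrow> 'a set" where
  "W n \<equiv> {..<omega n}"

lemma infinite_W: "infinite (W n)"
proof (induction n)
  case 0
  then show ?case
    using card_omega_0[OF omegas] infinite_iff_natLeq_ordLeq ordIso_iff_ordLeq by blast
next
  case (Suc n)
  have "|W n| \<le>o |W (Suc n)|"
    by (meson card_omega_Suc[OF omegas] cardSuc_greater card_of_Card_order ordIso_symmetric
        ordLess_imp_ordLeq ordLess_ordIso_trans)
  then show ?case
    using Suc card_of_ordLeq_infinite by blast
qed

lemma less_Suc_iff: "|A| <o |W (Suc n)| \<longleftrightarrow> |A| \<le>o |W n|"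
  by (meson card_omega_Suc[OF omegas] cardSuc_ordLeq_ordLess card_of_Card_order ordIso_symmetric
      ordLess_ordIso_trans)

lemma W_less_Suc: "|W n| <o |W (Suc n)|"
  using less_Suc_iff ordIso_imp_ordLeq[OF card_of_refl] by blast

lemma W_mono: "n \<le> m \<Longrightarrow> |W n| \<le>o |W m|"
  by (induction rule: dec_induct)
    (auto intro: ordLeq_transitive W_less_Suc ordLess_imp_ordLeq simp: card_of_refl ordIso_imp_ordLeq)

text \<open>Leastness in both clauses of \<open>omega\<close> makes \<open>omega n\<close> an
  initial ordinal.\<close>

lemma segment_less:
  fixes x :: 'a
  assumes "x < omega n"
  shows "|{..<x}| <o |W n|"
proof (cases n)
  case 0
  have "finite {..<x}"
    using assms not_less_Least[of x "\<lambda>\<kappa>. infinite {..<\<kappa>}"] unfolding 0 omega.simps by simp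
  then show ?thesis
    using finite_ordLess_infinite_set infinite_W by blast
next
  case (Suc k)
  have "\<not> |W k| <o |{..<x}|"
    using assms not_less_Least[of x "\<lambda>\<kappa>. |W k| <o |{..<\<kappa>}|"] unfolding Suc omega.simps by simp
  then show ?thesis
    unfolding Suc less_Suc_iff using not_ordLess_iff_ordLeq card_of_Well_order by blast
qed

lemma UN_le:
  assumes "|X| \<le>o |W n|" "\<And>x. x \<in> X \<Longrightarrow> |A x| \<le>o |W n|"
  shows "|\<Union>x\<in>X. A x| \<le>o |W n|"
  using card_of_UNION_ordLeq_infinite[OF infinite_W assms(1)] assms(2) by blast

lemma finite_le: "finite A \<Longrightarrow> |A| \<le>o |W n|"
  by (simp add: infinite_W finite_ordLess_infinite_set ordLess_imp_ordLeq)

lemma Un_le: "|A| \<le>o |W n| \<Longrightarrow> |B| \<le>o |W n| \<Longrightarrow> |A \<union> B| \<le>o |W n|"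
  using UN_le[of UNIV n "\<lambda>b. if b then A else B"] finite_le[of "UNIV :: bool set"]
  by (simp add: UNIV_bool Un_commute)

text \<open>Regularity of a successor cardinal: the closed segments below the points of
  \<open>S\<close> are at most \<open>omega n\<close> many sets of size at most
  \<open>omega n\<close>, so their union cannot exhaust \<open>W (Suc n)\<close>.\<close>

lemma bounded_in_Suc:
  fixes S :: "'a set"
  assumes "S \<subseteq> W (Suc n)" "|S| \<le>o |W n|"
  shows "\<exists>z < omega (Suc n). S \<subseteq> {..<z}"
proof -
  have "|{..x}| \<le>o |W n|" if "x \<in> S" for x
  proof -
    have "|{..<x}| \<le>o |W n|"
      using that assms(1) segment_less less_Suc_iff by blast
    moreover have "{..x} = {..<x} \<union> {x}"
      by auto
    ultimately show ?thesis
      using Un_le finite_le by (metis finite.emptyI finite.insertI)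
  qed
  then have "|\<Union>x\<in>S. {..x}| \<le>o |W n|"
    using UN_le assms(2) by blast
  then have "\<not> W (Suc n) \<subseteq> (\<Union>x\<in>S. {..x})"
    by (meson W_less_Suc card_of_mono1 not_ordLess_ordLeq ordLeq_transitive)
  then obtain z where "z < omega (Suc n)" "z \<notin> (\<Union>x\<in>S. {..x})"
    by blast
  then show ?thesis
    by (auto simp: not_le)
qed

end

section \<open>Calculus of normal ideals\<close>

lemma normal_ideal_subset:
  "normal_ideal_on \<mu> I \<Longrightarrow> A \<in> I \<Longrightarrow> B \<subseteq> A \<Longrightarrow> B \<in> I"
  by (auto simp: normal_ideal_on_def ideal_on_def)

lemma normal_ideal_Un: "normal_ideal_on \<mu> I \<Longrightarrow> A \<in> I \<Longrightarrow> B \<in> I \<Longrightarrow> A \<union> B \<in> I"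
  by (auto simp: normal_ideal_on_def ideal_on_def)

lemma normal_ideal_empty: "normal_ideal_on \<mu> I \<Longrightarrow> {} \<in> I"
  by (auto simp: normal_ideal_on_def ideal_on_def)

lemma normal_ideal_whole: "normal_ideal_on \<mu> I \<Longrightarrow> {..<\<mu>} \<notin> I"
  by (auto simp: normal_ideal_on_def ideal_on_def)

lemma normal_ideal_bounded: "normal_ideal_on \<mu> I \<Longrightarrow> A \<in> I \<Longrightarrow> A \<subseteq> {..<\<mu>}"
  by (auto simp: normal_ideal_on_def ideal_on_def)

lemma normal_ideal_UN:
  assumes "normal_ideal_on \<mu> I" "|X| <o |{..<\<mu>}|" "\<And>x. x \<in> X \<Longrightarrow> A x \<in> I"
  shows "(\<Union>x\<in>X. A x) \<in> I"
proof -
  have "|A ` X| <o |{..<\<mu>}|"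
    using card_of_image assms(2) ordLeq_ordLess_trans by blast
  then show ?thesis
    using assms(1,3) unfolding normal_ideal_on_def by (meson image_subsetI)
qed

lemma normal_ideal_small:
  assumes "normal_ideal_on \<mu> I" "|X| <o |{..<\<mu>}|" "X \<subseteq> {..<\<mu>}"
  shows "X \<in> I"
proof -
  have "(\<Union>x\<in>X. {x}) \<in> I"
    using assms by (intro normal_ideal_UN) (auto simp: normal_ideal_on_def)
  then show ?thesis
    by simp
qed

lemma normal_ideal_diagonal:
  assumes "normal_ideal_on \<mu> I" "\<And>x. x < \<mu> \<Longrightarrow> A x \<in> I"
  shows "{y. y < \<mu> \<and> (\<exists>x<y. y \<in> A x)} \<in> I"
  using assms unfolding normal_ideal_on_def by blast

lemma positive_Diff:
  assumes "normal_ideal_on \<mu> I" "A \<notin> I" "B \<in> I"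
  shows "A - B \<notin> I"
proof
  assume "A - B \<in> I"
  then have "(A - B) \<union> B \<in> I"
    using assms normal_ideal_Un by blast
  then show False
    using assms normal_ideal_subset by (metis Un_Diff_cancel2 Un_upper1)
qed

lemma ideal_Diff_trans:
  assumes "normal_ideal_on \<mu> I" "A - B \<in> I" "B - C \<in> I"
  shows "A - C \<in> I"
  using normal_ideal_Un[OF assms] by (rule normal_ideal_subset[OF assms(1)]) blast

text \<open>With the functions \<open>g \<gamma>\<close> read as representing the generic function
  in the generic ultrapower, this is the Boolean value of \<open>p\<close> belonging to the generic
  filter.\<close>

definition cylinder :: "'a::wellorder \<Rightarrow> ('a \<Rightarrow> 'a \<Rightarrow> 'a) \<Rightarrow> ('a \<rightharpoonup> 'a) \<Rightarrow> 'a set" where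
  "cylinder \<mu> g p = {\<gamma>. \<gamma> < \<mu> \<and> (\<forall>\<beta>\<in>dom p. p \<beta> = Some (g \<gamma> \<beta>))}"

text \<open>The cylinders embed the collapse densely into the positive sets modulo \<open>I\<close>.
  After \<open>generic_family_exists\<close> the isomorphism of Boolean algebras is used only in
  this form.\<close>

definition generic_family :: "'a::wellorder \<Rightarrow> 'a \<Rightarrow> 'a set set \<Rightarrow> ('a \<Rightarrow> 'a \<Rightarrow> 'a) \<Rightarrow> bool" where
  "generic_family \<kappa> \<mu> I g \<longleftrightarrow>
     normal_ideal_on \<mu> I \<and> (\<forall>p\<in>Col \<kappa> \<mu>. cylinder \<mu> g p \<notin> I) \<and>
     (\<forall>A\<subseteq>{..<\<mu>}. A \<notin> I \<longrightarrow> (\<exists>p\<in>Col \<kappa> \<mu>. cylinder \<mu> g p - A \<in> I))"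

section \<open>Regular open sets and the Boolean completion of the collapse\<close>

lemma regular_open_down:
  assumes refl: "\<And>p. p \<in> P \<Longrightarrow> le p p"
    and trans: "\<And>p q r. p \<in> P \<Longrightarrow> q \<in> P \<Longrightarrow> r \<in> P \<Longrightarrow> le p q \<Longrightarrow> le q r \<Longrightarrow> le p r"
  shows "regular_open_in (down_topology P le) V \<longleftrightarrow>
    V = {q\<in>P. \<forall>r\<in>P. le r q \<longrightarrow> (\<exists>s\<in>P. le s r \<and> s \<in> V)}"
proof -
  let ?X = "down_topology P le"
  have top: "topspace ?X = P"
    using openin_down_topology[of P le] by (metis openin_subset openin_topspace subset_antisym subset_refl)
  have down: "openin ?X {r\<in>P. le r q}" if "q \<in> P" for q
    using that trans unfolding openin_down_topology by blast
  \<comment> \<open>A condition is in the closure of \<open>V\<close> when some extension is in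
    \<open>V\<close>, and in the interior of a set when all its extensions are in the set. So
    \<open>V\<close> is regular open when it consists of exactly the conditions below which it is
    dense.\<close>
  have cl: "?X closure_of V = {q\<in>P. \<exists>s\<in>P. le s q \<and> s \<in> V}"
  proof (intro set_eqI iffI)
    fix q assume "q \<in> ?X closure_of V"
    then have "q \<in> P" "\<forall>T. q \<in> T \<and> openin ?X T \<longrightarrow> (\<exists>y. y \<in> V \<and> y \<in> T)"
      unfolding in_closure_of top by auto
    then obtain y where "y \<in> V" "y \<in> {r\<in>P. le r q}"
      using down refl by (metis (no_types, lifting) mem_Collect_eq)
    then show "q \<in> {q\<in>P. \<exists>s\<in>P. le s q \<and> s \<in> V}"
      using \<open>q \<in> P\<close> by auto
  next
    fix q assume "q \<in> {q\<in>P. \<exists>s\<in>P. le s q \<and> s \<in> V}"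
    then show "q \<in> ?X closure_of V"
      unfolding in_closure_of top openin_down_topology by blast
  qed
  have "?X interior_of S = {q\<in>P. \<forall>r\<in>P. le r q \<longrightarrow> r \<in> S}" for S
  proof (intro set_eqI iffI)
    fix q assume "q \<in> ?X interior_of S"
    then show "q \<in> {q\<in>P. \<forall>r\<in>P. le r q \<longrightarrow> r \<in> S}"
      unfolding interior_of_def openin_down_topology by blast
  next
    fix q assume "q \<in> {q\<in>P. \<forall>r\<in>P. le r q \<longrightarrow> r \<in> S}"
    then show "q \<in> ?X interior_of S"
      unfolding interior_of_def using down refl by (intro CollectI exI[of _ "{r\<in>P. le r q}"]) auto
  qed
  then have "?X interior_of (?X closure_of V) = {q\<in>P. \<forall>r\<in>P. le r q \<longrightarrow> (\<exists>s\<in>P. le s r \<and> s \<in> V)}"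
    unfolding cl by auto
  then show ?thesis
    unfolding regular_open_in_def by auto
qed

lemma Col_le_refl: "Col_le p p" and Col_le_trans: "Col_le p q \<Longrightarrow> Col_le q r \<Longrightarrow> Col_le p r"
  unfolding Col_le_def by (auto intro: map_le_trans)

lemma regular_open_Col:
  "regular_open_in (down_topology (Col \<kappa> \<mu>) Col_le) V \<longleftrightarrow>
    V = {q\<in>Col \<kappa> \<mu>. \<forall>r\<in>Col \<kappa> \<mu>. Col_le r q \<longrightarrow> (\<exists>s\<in>Col \<kappa> \<mu>. Col_le s r \<and> s \<in> V)}"
  by (rule regular_open_down) (auto intro: Col_le_refl Col_le_trans)

lemma Col_upd:
  assumes "p \<in> Col \<kappa> \<mu>" "\<beta> < \<kappa>" "\<delta> < \<mu>" "infinite {..<\<kappa>}"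
  shows "p(\<beta> \<mapsto> \<delta>) \<in> Col \<kappa> \<mu>"
proof -
  have "|{\<beta>} \<union> dom p| <o |{..<\<kappa>}|"
    using assms by (intro card_of_Un_ordLess_infinite) (auto simp: Col_def finite_ordLess_infinite_set)
  moreover have "ran (p(\<beta> \<mapsto> \<delta>)) \<subseteq> insert \<delta> (ran p)"
    by (auto simp: ran_def)
  ultimately show ?thesis
    using assms by (auto simp: Col_def)
qed

lemma Col_empty: "infinite {..<\<kappa>} \<Longrightarrow> Map.empty \<in> Col \<kappa> \<mu>"
  by (auto simp: Col_def finite_ordLess_infinite_set)

lemma Col_Un:
  assumes "p \<in> Col \<kappa> \<mu>" "q \<in> Col \<kappa> \<mu>" "infinite {..<\<kappa>}"
  shows "p ++ q \<in> Col \<kappa> \<mu>"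
proof -
  have "|dom q \<union> dom p| <o |{..<\<kappa>}|"
    using assms by (intro card_of_Un_ordLess_infinite) (auto simp: Col_def)
  moreover have "ran (p ++ q) \<subseteq> ran p \<union> ran q"
    by (auto simp: ran_def)
  ultimately show ?thesis
    using assms by (auto simp: Col_def)
qed

lemma regular_open_empty: "regular_open_in (down_topology (Col \<kappa> \<mu>) Col_le) {}"
  unfolding regular_open_Col using Col_le_refl by blast

text \<open>Separativity of the collapse: here one needs at least two values.\<close>

lemma regular_open_principal:
  assumes "infinite {..<\<kappa>}" "infinite {..<\<mu>}" "p \<in> Col \<kappa> \<mu>"
  shows "regular_open_in (down_topology (Col \<kappa> \<mu>) Col_le) {q\<in>Col \<kappa> \<mu>. Col_le q p}"
proof -
  have "Col_le q p" if q: "q \<in> Col \<kappa> \<mu>"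
    and dense: "\<forall>r\<in>Col \<kappa> \<mu>. Col_le r q \<longrightarrow> (\<exists>s\<in>Col \<kappa> \<mu>. Col_le s r \<and> Col_le s p)" for q
  proof (rule ccontr)
    assume "\<not> Col_le q p"
    then obtain \<beta> where \<beta>: "\<beta> \<in> dom p" "q \<beta> \<noteq> p \<beta>"
      unfolding Col_le_def map_le_def by metis
    have "\<exists>r\<in>Col \<kappa> \<mu>. Col_le r q \<and> \<beta> \<in> dom r \<and> r \<beta> \<noteq> p \<beta>"
    proof (cases "\<beta> \<in> dom q")
      case True
      then show ?thesis
        using \<beta> q Col_le_refl by blast
    next
      case False
      have "infinite ({..<\<mu>} - {the (p \<beta>)})"
        using assms(2) by simp
      then obtain \<delta> where \<delta>: "\<delta> < \<mu>" "\<delta> \<noteq> the (p \<beta>)"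
        by (metis Diff_iff finite.emptyI insertI1 lessThan_iff subset_emptyI subsetI finite_subset)
      have "q(\<beta> \<mapsto> \<delta>) \<in> Col \<kappa> \<mu>"
        using \<beta> assms q \<delta> by (intro Col_upd) (auto simp: Col_def)
      moreover have "Col_le (q(\<beta> \<mapsto> \<delta>)) q"
        using False by (auto simp: Col_le_def map_le_def)
      ultimately show ?thesis
        using \<delta> by (intro bexI[of _ "q(\<beta> \<mapsto> \<delta>)"]) (auto dest: sym)
    qed
    then obtain r where r: "r \<in> Col \<kappa> \<mu>" "Col_le r q" "\<beta> \<in> dom r" "r \<beta> \<noteq> p \<beta>"
      by blast
    then obtain s where "Col_le s r" "Col_le s p"
      using dense by blast
    then show False
      using r \<beta> unfolding Col_le_def map_le_def by metis
  qed
  moreover have "\<exists>s\<in>Col \<kappa> \<mu>. Col_le s r \<and> Col_le s p" if "r \<in> Col \<kappa> \<mu>" "Col_le r q" "Col_le q p" for q r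
    using that Col_le_refl Col_le_trans by blast
  ultimately show ?thesis
    unfolding regular_open_Col by blast
qed

text \<open>Composing the isomorphism with the class map gives \<open>\<Phi>\<close> on plain
  subsets and turns inclusion modulo \<open>I\<close> into inclusion, so that later arguments need
  not mention classes.\<close>

lemma powerset_mod_iso_boolean_completion:
  assumes I: "normal_ideal_on \<mu> I"
    and iso: "order_isomorphic (powerset_mod {..<\<mu>} I) (boolean_completion P le)"
  obtains \<Phi> where "\<And>A. A \<subseteq> {..<\<mu>} \<Longrightarrow> regular_open_in (down_topology P le) (\<Phi> A)"
    and "\<And>V. regular_open_in (down_topology P le) V \<Longrightarrow> \<exists>A\<subseteq>{..<\<mu>}. \<Phi> A = V"
    and "\<And>A B. A \<subseteq> {..<\<mu>} \<Longrightarrow> B \<subseteq> {..<\<mu>} \<Longrightarrow> A - B \<in> I \<longleftrightarrow> \<Phi> A \<subseteq> \<Phi> B"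
proof -
  let ?S = "{..<\<mu>}"
  let ?r = "powerset_mod ?S I" and ?s = "boolean_completion P le"
  define E where "E = {(A, B). A \<subseteq> ?S \<and> B \<subseteq> ?S \<and> sym_diff A B \<in> I}"
  define cls where "cls A = E `` {A}" for A
  have r: "?r = {(X, Y). X \<in> Pow ?S // E \<and> Y \<in> Pow ?S // E \<and> (\<exists>A\<in>X. \<exists>B\<in>Y. A - B \<in> I)}"
    unfolding powerset_mod_def Let_def E_def by simp
  have Q: "Pow ?S // E = cls ` Pow ?S"
    by (auto simp: quotient_def cls_def)
  have self: "A \<in> cls A" if "A \<subseteq> ?S" for A
    using that normal_ideal_empty[OF I] by (auto simp: cls_def E_def)
  have le: "(cls A, cls B) \<in> ?r \<longleftrightarrow> A - B \<in> I" if AB: "A \<subseteq> ?S" "B \<subseteq> ?S" for A B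
  proof
    assume "(cls A, cls B) \<in> ?r"
    then obtain A' B' where "A' \<in> cls A" "B' \<in> cls B" and AB': "A' - B' \<in> I"
      unfolding r by blast
    then have "sym_diff A A' \<in> I" "sym_diff B B' \<in> I"
      by (auto simp: cls_def E_def)
    then have "A - A' \<in> I" "B' - B \<in> I"
      using normal_ideal_subset[OF I] by blast+
    then show "A - B \<in> I"
      using AB' ideal_Diff_trans[OF I] by blast
  next
    assume "A - B \<in> I"
    then show "(cls A, cls B) \<in> ?r"
      unfolding r Q using AB self by blast
  qed
  have Fr: "Field ?r = cls ` Pow ?S"
  proof
    show "Field ?r \<subseteq> cls ` Pow ?S"
      unfolding r Q Field_def by auto
    have "(cls A, cls A) \<in> ?r" if "A \<subseteq> ?S" for A
      using le that normal_ideal_empty[OF I] by auto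
    then show "cls ` Pow ?S \<subseteq> Field ?r"
      by (auto simp: Field_def)
  qed
  have Fs: "Field ?s = {V. regular_open_in (down_topology P le) V}"
    by (auto simp: boolean_completion_def Field_def)
  obtain f where f: "bij_betw f (Field ?r) (Field ?s)"
    and mono: "\<And>a b. a \<in> Field ?r \<Longrightarrow> b \<in> Field ?r \<Longrightarrow> (a, b) \<in> ?r \<longleftrightarrow> (f a, f b) \<in> ?s"
    using iso unfolding order_isomorphic_def by blast
  have img: "f ` cls ` Pow ?S = {V. regular_open_in (down_topology P le) V}"
    using f unfolding bij_betw_def Fr Fs by simp
  have reg: "regular_open_in (down_topology P le) (f (cls A))" if "A \<subseteq> ?S" for A
    using img that by blast
  show thesis
  proof (rule that[of "f \<circ> cls"])
    show "regular_open_in (down_topology P le) ((f \<circ> cls) A)" if "A \<subseteq> ?S" for A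
      using reg that by simp
    show "\<exists>A\<subseteq>?S. (f \<circ> cls) A = V" if "regular_open_in (down_topology P le) V" for V
    proof -
      have "V \<in> f ` cls ` Pow ?S"
        using that img by simp
      then show ?thesis
        by auto
    qed
    show "A - B \<in> I \<longleftrightarrow> (f \<circ> cls) A \<subseteq> (f \<circ> cls) B" if "A \<subseteq> ?S" "B \<subseteq> ?S" for A B
      using le[OF that] mono[of "cls A" "cls B"] that reg unfolding Fr
      by (auto simp: boolean_completion_def)
  qed
qed

section \<open>Functions representing the generic collapse\<close>

text \<open>
  By normality the antichain of sets representing the possible values at \<open>\<beta>\<close> can be made disjoint,
  which defines \<open>g \<gamma> \<beta>\<close>.
\<close>

lemma generic_family_exists:
  fixes \<kappa> \<mu> :: "'a::wellorder"
  assumes I: "normal_ideal_on \<mu> I"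
    and iso: "order_isomorphic (powerset_mod {..<\<mu>} I) (boolean_completion (Col \<kappa> \<mu>) Col_le)"
    and inf: "infinite {..<\<kappa>}" and le: "|{..<\<kappa>}| \<le>o |{..<\<mu>}|"
    and seg: "\<And>x. x < \<mu> \<Longrightarrow> |{..<x}| <o |{..<\<mu>}|"
  shows "\<exists>g. generic_family \<kappa> \<mu> I g"
proof -
  let ?S = "{..<\<mu>}" and ?P = "Col \<kappa> \<mu>"
  have inf': "infinite ?S"
    using inf le card_of_ordLeq_infinite by blast
  obtain \<Phi> where reg: "\<And>A. A \<subseteq> ?S \<Longrightarrow> regular_open_in (down_topology ?P Col_le) (\<Phi> A)"
    and surj: "\<And>V. regular_open_in (down_topology ?P Col_le) V \<Longrightarrow> \<exists>A\<subseteq>?S. \<Phi> A = V"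
    and ord: "\<And>A B. A \<subseteq> ?S \<Longrightarrow> B \<subseteq> ?S \<Longrightarrow> A - B \<in> I \<longleftrightarrow> \<Phi> A \<subseteq> \<Phi> B"
    apply (rule powerset_mod_iso_boolean_completion[OF I iso])
    subgoal premises prems for \<Phi>
      by (rule prems(1)[of \<Phi>]) (fact prems)+
    done
  \<comment> \<open>\<open>U p\<close> is the principal regular open set of \<open>p\<close>; the
    set \<open>e p\<close> chosen below represents it and is determined up to the ideal.\<close>
  define U where "U p = {q\<in>?P. Col_le q p}" for p
  have "\<forall>p\<in>?P. \<exists>A. A \<subseteq> ?S \<and> \<Phi> A = U p"
    using surj regular_open_principal[OF inf inf'] unfolding U_def by blast
  then obtain e where eS: "\<And>p. p \<in> ?P \<Longrightarrow> e p \<subseteq> ?S" and eU: "\<And>p. p \<in> ?P \<Longrightarrow> \<Phi> (e p) = U p"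
    by metis
  have null: "\<Phi> A = {}" if "A \<in> I" for A
  proof -
    obtain B where B: "B \<subseteq> ?S" "\<Phi> B = {}"
      using surj[OF regular_open_empty] by blast
    have "A - B \<in> I" "A \<subseteq> ?S"
      using that normal_ideal_subset[OF I] normal_ideal_bounded[OF I] by blast+
    then show ?thesis
      using ord B by blast
  qed
  have null': "A \<in> I" if "A \<subseteq> ?S" "\<Phi> A = {}" for A
    using ord[of A "{}"] that by simp
  have e_pos: "e p \<notin> I" if "p \<in> ?P" for p
    using null[of "e p"] eU[OF that] that Col_le_refl unfolding U_def by blast
  have e_le: "e p - e q \<in> I \<longleftrightarrow> Col_le p q" if "p \<in> ?P" "q \<in> ?P" for p q
  proof -
    have "U p \<subseteq> U q \<longleftrightarrow> Col_le p q"
      unfolding U_def using that Col_le_refl Col_le_trans by blast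
    then show ?thesis
      using ord eS eU that by simp
  qed
  have dens: "\<exists>p\<in>?P. e p - A \<in> I" if A: "A \<subseteq> ?S" "A \<notin> I" for A
  proof -
    obtain p where p: "p \<in> \<Phi> A"
      using null' A by blast
    have V: "\<Phi> A = {q\<in>?P. \<forall>r\<in>?P. Col_le r q \<longrightarrow> (\<exists>s\<in>?P. Col_le s r \<and> s \<in> \<Phi> A)}"
      using reg[OF A(1)] unfolding regular_open_Col .
    have pP: "p \<in> ?P" and pd: "\<And>r. r \<in> ?P \<Longrightarrow> Col_le r p \<Longrightarrow> \<exists>s\<in>?P. Col_le s r \<and> s \<in> \<Phi> A"
      using p V by auto
    have "U p \<subseteq> \<Phi> A"
    proof
      fix q assume "q \<in> U p"
      then have "q \<in> ?P" "Col_le q p"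
        by (auto simp: U_def)
      then show "q \<in> \<Phi> A"
        by (subst V) (auto intro: pd Col_le_trans)
    qed
    then show ?thesis
      using pP ord[OF eS A(1)] eU by blast
  qed
  \<comment> \<open>\<open>a \<beta> \<delta>\<close> stands for the event that the generic function
    takes the value \<delta> at \<beta>.\<close>
  define a where "a \<beta> \<delta> = e [\<beta> \<mapsto> \<delta>]" for \<beta> \<delta>
  have single: "[\<beta> \<mapsto> \<delta>] \<in> ?P" if "\<beta> < \<kappa>" "\<delta> < \<mu>" for \<beta> \<delta>
    using Col_upd[OF Col_empty] that inf by blast
  have single_le: "Col_le p [\<beta> \<mapsto> \<delta>] \<longleftrightarrow> p \<beta> = Some \<delta>" for p :: "'a \<rightharpoonup> 'a" and \<beta> \<delta>
    by (auto simp: Col_le_def map_le_def)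
  have e_a: "e p - a \<beta> \<delta> \<in> I \<longleftrightarrow> p \<beta> = Some \<delta>" if "p \<in> ?P" "\<beta> < \<kappa>" "\<delta> < \<mu>" for p \<beta> \<delta>
    unfolding a_def using e_le[OF that(1) single[OF that(2,3)]] single_le by simp
  have aS: "a \<beta> \<delta> \<subseteq> ?S" if "\<beta> < \<kappa>" "\<delta> < \<mu>" for \<beta> \<delta>
    unfolding a_def using eS single that by blast
  have disj: "a \<beta> \<delta> \<inter> a \<beta> \<delta>' \<in> I" if "\<beta> < \<kappa>" "\<delta> < \<mu>" "\<delta>' < \<mu>" "\<delta> \<noteq> \<delta>'" for \<beta> \<delta> \<delta>'
  proof (rule ccontr)
    assume "a \<beta> \<delta> \<inter> a \<beta> \<delta>' \<notin> I"
    moreover have "a \<beta> \<delta> \<inter> a \<beta> \<delta>' \<subseteq> ?S"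
      using aS that by blast
    ultimately obtain p where p: "p \<in> ?P" "e p - (a \<beta> \<delta> \<inter> a \<beta> \<delta>') \<in> I"
      using dens by blast
    then have "e p - a \<beta> \<delta> \<in> I" "e p - a \<beta> \<delta>' \<in> I"
      using normal_ideal_subset[OF I] by blast+
    then show False
      using e_a p(1) that by simp
  qed
  have init: "{..\<delta>} \<in> I" if "\<delta> < \<mu>" for \<delta>
  proof -
    have "{..<\<delta>} \<in> I"
      using that by (intro normal_ideal_small[OF I seg]) auto
    moreover have "{\<delta>} \<in> I"
      using I that by (auto simp: normal_ideal_on_def)
    moreover have "{..\<delta>} = {..<\<delta>} \<union> {\<delta>}"
      by auto
    ultimately show ?thesis
      using normal_ideal_Un[OF I] by metis
  qed
  \<comment> \<open>For fixed \<beta>, \<open>N1\<close> collects the \<gamma> lying in two of the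
    sets with index below \<gamma>, \<open>N2\<close> those lying in none. Both turn out to be null,
    \<open>N1\<close> as a diagonal union and \<open>N2\<close> by density; off both, exactly one
    \<delta> below \<gamma> qualifies.\<close>
  define N1 where "N1 \<beta> = {\<gamma>. \<gamma> < \<mu> \<and> (\<exists>\<delta><\<gamma>. \<gamma> \<in> (\<Union>\<delta>'\<in>{..<\<delta>}. a \<beta> \<delta> \<inter> a \<beta> \<delta>'))}" for \<beta>
  define N2 where "N2 \<beta> = {\<gamma>. \<gamma> < \<mu> \<and> (\<forall>\<delta><\<gamma>. \<gamma> \<notin> a \<beta> \<delta>)}" for \<beta>
  have N1: "N1 \<beta> \<in> I" if "\<beta> < \<kappa>" for \<beta>
  proof -
    have "(\<Union>\<delta>'\<in>{..<\<delta>}. a \<beta> \<delta> \<inter> a \<beta> \<delta>') \<in> I" if "\<delta> < \<mu>" for \<delta>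
      using that \<open>\<beta> < \<kappa>\<close> by (intro normal_ideal_UN[OF I seg] disj) auto
    then show ?thesis
      unfolding N1_def by (rule normal_ideal_diagonal[OF I])
  qed
  have N2: "N2 \<beta> \<in> I" if \<beta>: "\<beta> < \<kappa>" for \<beta>
  proof (rule ccontr)
    assume "N2 \<beta> \<notin> I"
    moreover have "N2 \<beta> \<subseteq> ?S"
      by (auto simp: N2_def)
    ultimately obtain p where p: "p \<in> ?P" "e p - N2 \<beta> \<in> I"
      using dens by blast
    \<comment> \<open>Extend \<open>p\<close> to decide the value at \<beta>. Then
      \<open>e q\<close> is almost contained in both \<open>N2 \<beta>\<close> and
      \<open>a \<beta> \<delta>\<close>, but a common point of these is at most \<delta>, and
      \<open>{..\<delta>}\<close> is null.\<close>
    obtain q \<delta> where q: "q \<in> ?P" "Col_le q p" "q \<beta> = Some \<delta>" "\<delta> < \<mu>"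
    proof (cases "p \<beta>")
      case None
      have "?S \<noteq> {}"
        using inf' by auto
      then obtain \<delta> where "\<delta> < \<mu>"
        by auto
      then have "p(\<beta> \<mapsto> \<delta>) \<in> ?P" "Col_le (p(\<beta> \<mapsto> \<delta>)) p"
        using Col_upd[OF p(1) \<beta> _ inf] None by (auto simp: Col_le_def map_le_def)
      then show ?thesis
        using that[of "p(\<beta> \<mapsto> \<delta>)"] \<open>\<delta> < \<mu>\<close> by simp
    next
      case (Some \<delta>)
      then have "\<delta> < \<mu>"
        using p(1) ranI unfolding Col_def by fastforce
      then show ?thesis
        using that p(1) Some Col_le_refl by blast
    qed
    have "e q - N2 \<beta> \<in> I"
      using p q e_le ideal_Diff_trans[OF I] by blast
    moreover have "e q - a \<beta> \<delta> \<in> I"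
      using e_a q \<beta> by blast
    ultimately have "(e q - N2 \<beta>) \<union> (e q - a \<beta> \<delta>) \<union> {..\<delta>} \<in> I"
      using init[OF q(4)] normal_ideal_Un[OF I] by blast
    then have "e q \<in> I"
      by (rule normal_ideal_subset[OF I]) (auto simp: N2_def not_less)
    then show False
      using e_pos q(1) by blast
  qed
  \<comment> \<open>On \<open>N2 \<beta>\<close> there is no candidate and the value is arbitrary;
    as this set is null, the cylinders are not affected modulo \<open>I\<close>.\<close>
  define g where "g \<gamma> \<beta> = (SOME \<delta>. \<delta> < \<gamma> \<and> \<gamma> \<in> a \<beta> \<delta>)" for \<gamma> \<beta>
  have g: "g \<gamma> \<beta> < \<gamma> \<and> \<gamma> \<in> a \<beta> (g \<gamma> \<beta>)" if "\<gamma> < \<mu>" "\<gamma> \<notin> N2 \<beta>" for \<gamma> \<beta>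
  proof -
    have "\<exists>\<delta>. \<delta> < \<gamma> \<and> \<gamma> \<in> a \<beta> \<delta>"
      using that by (auto simp: N2_def)
    then show ?thesis
      unfolding g_def by (rule someI_ex)
  qed
  define E where "E \<beta> \<delta> = {\<gamma>. \<gamma> < \<mu> \<and> g \<gamma> \<beta> = \<delta>}" for \<beta> \<delta>
  have E_a: "E \<beta> \<delta> - a \<beta> \<delta> \<in> I" if "\<beta> < \<kappa>" for \<beta> \<delta>
    by (rule normal_ideal_subset[OF I N2[OF that]]) (use g in \<open>auto simp: E_def\<close>)
  have a_E: "a \<beta> \<delta> - E \<beta> \<delta> \<in> I" if \<beta>: "\<beta> < \<kappa>" and \<delta>: "\<delta> < \<mu>" for \<beta> \<delta>
  proof (rule normal_ideal_subset[OF I])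
    show "N1 \<beta> \<union> N2 \<beta> \<union> {..\<delta>} \<in> I"
      using N1 N2 init that normal_ideal_Un[OF I] by simp
    show "a \<beta> \<delta> - E \<beta> \<delta> \<subseteq> N1 \<beta> \<union> N2 \<beta> \<union> {..\<delta>}"
    proof
      fix \<gamma> assume "\<gamma> \<in> a \<beta> \<delta> - E \<beta> \<delta>"
      then have \<gamma>: "\<gamma> < \<mu>" "\<gamma> \<in> a \<beta> \<delta>" "g \<gamma> \<beta> \<noteq> \<delta>"
        using aS[OF that] by (auto simp: E_def)
      show "\<gamma> \<in> N1 \<beta> \<union> N2 \<beta> \<union> {..\<delta>}"
      proof (rule ccontr)
        assume *: "\<gamma> \<notin> N1 \<beta> \<union> N2 \<beta> \<union> {..\<delta>}"
        then have "g \<gamma> \<beta> < \<gamma>" "\<gamma> \<in> a \<beta> (g \<gamma> \<beta>)" "\<delta> < \<gamma>"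
          using g \<gamma>(1) by auto
        then have "\<gamma> \<in> N1 \<beta>"
          using \<gamma> by (cases "g \<gamma> \<beta>" \<delta> rule: linorder_cases) (auto simp: N1_def)
        then show False
          using * by blast
      qed
    qed
  qed
  have val: "\<beta> < \<kappa> \<and> \<delta> < \<mu>" if "p \<in> ?P" "p \<beta> = Some \<delta>" for p \<beta> \<delta>
    using that ranI[of p] unfolding Col_def by blast
  have cyl: "cylinder \<mu> g p = {\<gamma>. \<gamma> < \<mu> \<and> (\<forall>\<beta> \<delta>. p \<beta> = Some \<delta> \<longrightarrow> \<gamma> \<in> E \<beta> \<delta>)}" for p
    by (auto simp: cylinder_def E_def dom_def)
  have e_cyl: "e p - cylinder \<mu> g p \<in> I" if p: "p \<in> ?P" for p
  proof -
    have "|dom p| <o |?S|"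
      using p le ordLess_ordLeq_trans unfolding Col_def by blast
    moreover have "e p - E \<beta> (the (p \<beta>)) \<in> I" if "\<beta> \<in> dom p" for \<beta>
      using that val[OF p] e_a[OF p] a_E ideal_Diff_trans[OF I] by (metis domD option.sel)
    ultimately have "(\<Union>\<beta>\<in>dom p. e p - E \<beta> (the (p \<beta>))) \<in> I"
      by (intro normal_ideal_UN[OF I])
    then show ?thesis
    proof (rule normal_ideal_subset[OF I])
      show "e p - cylinder \<mu> g p \<subseteq> (\<Union>\<beta>\<in>dom p. e p - E \<beta> (the (p \<beta>)))"
      proof
        fix \<gamma> assume \<gamma>: "\<gamma> \<in> e p - cylinder \<mu> g p"
        then obtain \<beta> \<delta> where "p \<beta> = Some \<delta>" "\<gamma> \<notin> E \<beta> \<delta>"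
          using eS[OF p] unfolding cyl by auto
        then show "\<gamma> \<in> (\<Union>\<beta>\<in>dom p. e p - E \<beta> (the (p \<beta>)))"
          using \<gamma> by (intro UN_I[of \<beta>]) auto
      qed
    qed
  qed
  \<comment> \<open>By density a positive difference would almost contain some \<open>e q\<close>.
    Being almost inside the cylinder of \<open>p\<close>, this forces \<open>q\<close> to extend
    \<open>p\<close>, so \<open>e q\<close> is almost inside \<open>e p\<close> as well and hence
    null.\<close>
  have cyl_e: "cylinder \<mu> g p - e p \<in> I" if p: "p \<in> ?P" for p
  proof (rule ccontr)
    assume "cylinder \<mu> g p - e p \<notin> I"
    moreover have "cylinder \<mu> g p - e p \<subseteq> ?S"
      by (auto simp: cyl)
    ultimately obtain q where q: "q \<in> ?P" "e q - (cylinder \<mu> g p - e p) \<in> I"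
      using dens by blast
    have "q \<beta> = Some \<delta>" if "p \<beta> = Some \<delta>" for \<beta> \<delta>
    proof -
      have "e q - E \<beta> \<delta> \<in> I"
        by (rule normal_ideal_subset[OF I q(2)]) (use that in \<open>auto simp: cyl\<close>)
      then have "e q - a \<beta> \<delta> \<in> I"
        using E_a val[OF p that] ideal_Diff_trans[OF I] by blast
      then show ?thesis
        using e_a[OF q(1)] val[OF p that] by blast
    qed
    then have "Col_le q p"
      by (auto simp: Col_le_def map_le_def)
    then have "(e q - e p) \<union> (e q - (cylinder \<mu> g p - e p)) \<in> I"
      using q e_le[OF q(1) p] normal_ideal_Un[OF I] by blast
    then have "e q \<in> I"
      by (rule normal_ideal_subset[OF I]) blast
    then show False
      using e_pos q(1) by blast
  qed
  have "cylinder \<mu> g p \<notin> I" if "p \<in> ?P" for p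
  proof
    assume "cylinder \<mu> g p \<in> I"
    then have "(e p - cylinder \<mu> g p) \<union> cylinder \<mu> g p \<in> I"
      using e_cyl[OF that] normal_ideal_Un[OF I] by blast
    then have "e p \<in> I"
      by (rule normal_ideal_subset[OF I]) blast
    then show False
      using e_pos that by blast
  qed
  moreover have "\<exists>p\<in>?P. cylinder \<mu> g p - A \<in> I" if "A \<subseteq> ?S" "A \<notin> I" for A
    using dens[OF that] cyl_e ideal_Diff_trans[OF I] by blast
  ultimately show ?thesis
    using I unfolding generic_family_def by blast
qed

lemma cylinder_antimono: "p \<subseteq>\<^sub>m q \<Longrightarrow> cylinder \<mu> g q \<subseteq> cylinder \<mu> g p"
  unfolding cylinder_def map_le_def by (auto dest: domI) (metis domIff option.distinct(1))

lemma generic_family_normal: "generic_family \<kappa> \<mu> I g \<Longrightarrow> normal_ideal_on \<mu> I"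
  by (simp add: generic_family_def)

lemma generic_family_positive: "generic_family \<kappa> \<mu> I g \<Longrightarrow> p \<in> Col \<kappa> \<mu> \<Longrightarrow> cylinder \<mu> g p \<notin> I"
  by (simp add: generic_family_def)

text \<open>A condition \<open>q\<close> whose cylinder is almost inside \<open>A\<close> shares a
  point \<gamma> with the cylinder of \<open>p\<close>. Both agree with \<open>g \<gamma>\<close> on
  their domains, so they are compatible and \<open>p ++ q\<close> serves.\<close>

lemma generic_family_extend:
  assumes G: "generic_family \<kappa> \<mu> I g" and inf: "infinite {..<\<kappa>}"
    and p: "p \<in> Col \<kappa> \<mu>" and A: "A \<subseteq> cylinder \<mu> g p" "A \<notin> I"
  shows "\<exists>q\<in>Col \<kappa> \<mu>. p \<subseteq>\<^sub>m q \<and> cylinder \<mu> g q - A \<in> I"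
proof -
  note I = generic_family_normal[OF G]
  have "A \<subseteq> {..<\<mu>}"
    using A(1) by (auto simp: cylinder_def)
  then obtain q where q: "q \<in> Col \<kappa> \<mu>" "cylinder \<mu> g q - A \<in> I"
    using G A(2) unfolding generic_family_def by blast
  have "\<not> cylinder \<mu> g q \<subseteq> cylinder \<mu> g q - A"
    using q generic_family_positive[OF G] normal_ideal_subset[OF I] by blast
  then obtain \<gamma> where "\<gamma> \<in> cylinder \<mu> g q" "\<gamma> \<in> cylinder \<mu> g p"
    using A(1) by blast
  then have "p \<subseteq>\<^sub>m p ++ q"
    unfolding cylinder_def map_le_def map_add_def
    by (auto split: option.splits) (metis domI option.inject)
  moreover have "cylinder \<mu> g (p ++ q) - A \<in> I"
    using q(2) cylinder_antimono[of q "p ++ q" \<mu> g] by (auto intro: normal_ideal_subset[OF I])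
  ultimately show ?thesis
    using Col_Un[OF p q(1) inf] by blast
qed

lemma map_chain_union:
  assumes "\<And>p q. p \<in> F \<Longrightarrow> q \<in> F \<Longrightarrow> p \<subseteq>\<^sub>m q \<or> q \<subseteq>\<^sub>m p"
  shows "\<exists>u. (\<forall>p\<in>F. p \<subseteq>\<^sub>m u) \<and> dom u = (\<Union>p\<in>F. dom p) \<and> ran u \<subseteq> (\<Union>p\<in>F. ran p)"
proof -
  define u where "u x = (if \<exists>p\<in>F. x \<in> dom p then (SOME p. p \<in> F \<and> x \<in> dom p) x else None)" for x
  have u: "u x = p x" if "p \<in> F" "x \<in> dom p" for p x
  proof -
    have "(SOME p. p \<in> F \<and> x \<in> dom p) \<in> F \<and> x \<in> dom (SOME p. p \<in> F \<and> x \<in> dom p)"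
      using that by (intro someI[of "\<lambda>p. p \<in> F \<and> x \<in> dom p"]) simp
    then have "(SOME p. p \<in> F \<and> x \<in> dom p) x = p x"
      using assms that unfolding map_le_def by metis
    then show ?thesis
      using that by (auto simp: u_def)
  qed
  have u': "\<exists>p\<in>F. p x = Some y" if "u x = Some y" for x y
  proof -
    have "\<exists>p\<in>F. x \<in> dom p"
      using that by (auto simp: u_def split: if_splits)
    then show ?thesis
      using u that by metis
  qed
  have "dom u = (\<Union>p\<in>F. dom p)"
  proof
    show "dom u \<subseteq> (\<Union>p\<in>F. dom p)"
      using u' by blast
    show "(\<Union>p\<in>F. dom p) \<subseteq> dom u"
      using u by fastforce
  qed
  moreover have "ran u \<subseteq> (\<Union>p\<in>F. ran p)"
    using u' by (fastforce simp: ran_def)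
  ultimately show ?thesis
    using u by (intro exI[of _ u]) (auto simp: map_le_def)
qed

section \<open>Closure of the collapse and the size of the power set of
  \<open>omega n\<close>\<close>

context omegas
begin

text \<open>A union of at most \<open>omega k\<close> domains of at most that size is still small
  enough. The exact domain is recorded because \<open>generic_chain\<close> has to find each of its
  points in an earlier condition.\<close>

lemma Col_chain_bound:
  assumes "F \<subseteq> Col (omega (Suc k) :: 'a) \<mu>" "|F| \<le>o |W k|"
    and "\<And>p q. p \<in> F \<Longrightarrow> q \<in> F \<Longrightarrow> p \<subseteq>\<^sub>m q \<or> q \<subseteq>\<^sub>m p"
  shows "\<exists>u\<in>Col (omega (Suc k)) \<mu>. (\<forall>p\<in>F. p \<subseteq>\<^sub>m u) \<and> dom u = (\<Union>p\<in>F. dom p)"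
proof -
  obtain u where u: "\<forall>p\<in>F. p \<subseteq>\<^sub>m u" "dom u = (\<Union>p\<in>F. dom p)" "ran u \<subseteq> (\<Union>p\<in>F. ran p)"
    using map_chain_union[OF assms(3)] by metis
  have "|dom p| \<le>o |W k|" if "p \<in> F" for p
    using that assms(1) less_Suc_iff unfolding Col_def by blast
  then have "|dom u| \<le>o |W k|"
    unfolding u(2) by (intro UN_le assms(2))
  then have "u \<in> Col (omega (Suc k)) \<mu>"
    using u assms(1) less_Suc_iff unfolding Col_def by blast
  then show ?thesis
    using u by blast
qed

text \<open>As the collapse is closed under chains of length \<open>omega n\<close>, a single
  condition decides all \<open>omega n\<close> bits of the subset represented by \<open>S\<close>.
  So \<open>S\<close> is constant on a positive set, which has two elements, against
  injectivity.\<close>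

lemma Pow_le_of_generic_family:
  assumes G: "generic_family (omega (Suc n) :: 'a) (omega (Suc (Suc n))) I g"
  shows "|Pow (W n)| \<le>o |W (Suc n)|"
proof (rule ccontr)
  let ?\<kappa> = "omega (Suc n) :: 'a" and ?\<mu> = "omega (Suc (Suc n)) :: 'a"
  let ?P = "Col ?\<kappa> ?\<mu>" and ?c = "cylinder ?\<mu> g"
  note I = generic_family_normal[OF G]
  assume "\<not> |Pow (W n)| \<le>o |W (Suc n)|"
  then have "|W (Suc (Suc n))| \<le>o |Pow (W n)|"
    using less_Suc_iff by (metis card_of_Well_order not_ordLess_iff_ordLeq)
  then obtain S where S: "inj_on S (W (Suc (Suc n)))" "S ` W (Suc (Suc n)) \<subseteq> Pow (W n)"
    unfolding card_of_ordLeq[symmetric] by blast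
  define D where "D \<alpha> p \<longleftrightarrow> ?c p - {\<gamma>. \<alpha> \<in> S \<gamma>} \<in> I \<or> ?c p \<inter> {\<gamma>. \<alpha> \<in> S \<gamma>} \<in> I" for \<alpha> p
  have bound: "\<exists>u\<in>?P. \<forall>\<beta>\<in>X. f \<beta> \<subseteq>\<^sub>m u"
    if X: "|X| \<le>o |W n|" and f: "\<And>\<beta>. \<beta> \<in> X \<Longrightarrow> f \<beta> \<in> ?P"
      "\<And>\<beta> \<beta>'. \<beta> \<in> X \<Longrightarrow> \<beta>' \<in> X \<Longrightarrow> \<beta> < \<beta>' \<Longrightarrow> f \<beta> \<subseteq>\<^sub>m f \<beta>'" for X :: "'a set" and f
  proof -
    have "f ` X \<subseteq> ?P" "|f ` X| \<le>o |W n|"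
      using f X card_of_image ordLeq_transitive by blast+
    moreover have "p \<subseteq>\<^sub>m q \<or> q \<subseteq>\<^sub>m p" if "p \<in> f ` X" "q \<in> f ` X" for p q
      using that f(2) by (metis (no_types, lifting) image_iff linorder_neqE map_le_refl)
    ultimately show ?thesis
      using Col_chain_bound by (metis image_eqI)
  qed
  have "\<exists>f. \<forall>\<alpha>. \<alpha> < omega n \<longrightarrow> f \<alpha> \<in> ?P \<and> (\<forall>\<beta><\<alpha>. f \<beta> \<subseteq>\<^sub>m f \<alpha>) \<and> D \<alpha> (f \<alpha>)"
  proof (rule dependent_wellorder_choice)
    show "\<exists>p. \<alpha> < omega n \<longrightarrow> p \<in> ?P \<and> (\<forall>\<beta><\<alpha>. f \<beta> \<subseteq>\<^sub>m p) \<and> D \<alpha> p"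
      if IH: "\<And>\<beta>. \<beta> < \<alpha> \<Longrightarrow> \<beta> < omega n \<longrightarrow> f \<beta> \<in> ?P \<and> (\<forall>\<eta><\<beta>. f \<eta> \<subseteq>\<^sub>m f \<beta>) \<and> D \<beta> (f \<beta>)"
      for \<alpha> :: 'a and f
    proof (cases "\<alpha> < omega n")
      case True
      have "|{..<\<alpha>}| \<le>o |W n|"
        using segment_less[OF True] ordLess_imp_ordLeq by blast
      moreover have "f \<beta> \<in> ?P \<and> (\<forall>\<eta><\<beta>. f \<eta> \<subseteq>\<^sub>m f \<beta>)" if "\<beta> < \<alpha>" for \<beta>
        using IH[OF that] less_trans[OF that True] by blast
      ultimately obtain u where u: "u \<in> ?P" "\<forall>\<beta>\<in>{..<\<alpha>}. f \<beta> \<subseteq>\<^sub>m u"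
        using bound[of "{..<\<alpha>}" f] by auto
      show ?thesis
      proof (cases "?c u \<inter> {\<gamma>. \<alpha> \<in> S \<gamma>} \<in> I")
        case True
        then show ?thesis
          using u by (auto simp: D_def)
      next
        case False
        then obtain q where q: "q \<in> ?P" "u \<subseteq>\<^sub>m q" "?c q - (?c u \<inter> {\<gamma>. \<alpha> \<in> S \<gamma>}) \<in> I"
          using generic_family_extend[OF G infinite_W u(1), of "?c u \<inter> {\<gamma>. \<alpha> \<in> S \<gamma>}"] by auto
        then have "?c q - {\<gamma>. \<alpha> \<in> S \<gamma>} \<in> I"
          by (auto intro: normal_ideal_subset[OF I])
        then have "D \<alpha> q"
          by (simp add: D_def)
        moreover have "\<forall>\<beta><\<alpha>. f \<beta> \<subseteq>\<^sub>m q"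
          using u(2) q(2) map_le_trans by blast
        ultimately show ?thesis
          using q(1) by blast
      qed
    qed auto
  qed auto
  then obtain f where f: "\<And>\<alpha>. \<alpha> < omega n \<Longrightarrow> f \<alpha> \<in> ?P \<and> (\<forall>\<beta><\<alpha>. f \<beta> \<subseteq>\<^sub>m f \<alpha>) \<and> D \<alpha> (f \<alpha>)"
    by blast
  obtain u where u: "u \<in> ?P" "\<forall>\<beta>\<in>W n. f \<beta> \<subseteq>\<^sub>m u"
    using bound[of "W n" f] f ordIso_imp_ordLeq[OF card_of_refl] by (metis lessThan_iff)
  \<comment> \<open>\<open>S0\<close> is the subset read off from \<open>u\<close>, and
    \<open>N \<alpha>\<close> is the null set of those \<gamma> in the cylinder whose
    \<open>S \<gamma>\<close> differs from it at \<alpha>.\<close>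
  define S0 where "S0 = {\<alpha>. \<alpha> < omega n \<and> ?c u - {\<gamma>. \<alpha> \<in> S \<gamma>} \<in> I}"
  define N where "N \<alpha> = (if \<alpha> \<in> S0 then ?c u - {\<gamma>. \<alpha> \<in> S \<gamma>} else ?c u \<inter> {\<gamma>. \<alpha> \<in> S \<gamma>})" for \<alpha>
  have "N \<alpha> \<in> I" if "\<alpha> < omega n" for \<alpha>
  proof (cases "\<alpha> \<in> S0")
    case False
    then have "?c u - {\<gamma>. \<alpha> \<in> S \<gamma>} \<notin> I"
      using that by (simp add: S0_def)
    moreover have "?c u \<subseteq> ?c (f \<alpha>)"
      using that u(2) cylinder_antimono by blast
    ultimately have "?c u \<inter> {\<gamma>. \<alpha> \<in> S \<gamma>} \<in> I"
      using f[OF that] normal_ideal_subset[OF I] unfolding D_def by (meson Diff_mono Int_mono order_refl)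
    then show ?thesis
      using False by (simp add: N_def)
  qed (simp add: N_def S0_def)
  moreover have "|W n| <o |W (Suc (Suc n))|"
    using W_less_Suc ordLess_transitive by blast
  ultimately have "(\<Union>\<alpha>\<in>W n. N \<alpha>) \<in> I"
    using normal_ideal_UN[OF I] by (metis lessThan_iff)
  then have pos: "?c u - (\<Union>\<alpha>\<in>W n. N \<alpha>) \<notin> I"
    using positive_Diff[OF I] generic_family_positive[OF G u(1)] by blast
  have S0: "S \<gamma> = S0" if "\<gamma> \<in> ?c u - (\<Union>\<alpha>\<in>W n. N \<alpha>)" for \<gamma>
  proof -
    have "S \<gamma> \<subseteq> W n"
      using S(2) that by (auto simp: cylinder_def)
    moreover have "\<alpha> \<in> S \<gamma> \<longleftrightarrow> \<alpha> \<in> S0" if "\<alpha> < omega n" for \<alpha>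
      using that \<open>\<gamma> \<in> _\<close> by (auto simp: N_def split: if_splits)
    moreover have "S0 \<subseteq> W n"
      by (auto simp: S0_def)
    ultimately show ?thesis
      by blast
  qed
  obtain \<gamma> where \<gamma>: "\<gamma> \<in> ?c u - (\<Union>\<alpha>\<in>W n. N \<alpha>)"
    using pos normal_ideal_empty[OF I] by (metis ex_in_conv)
  have "{\<gamma>} \<in> I"
    using \<gamma> I by (auto simp: cylinder_def normal_ideal_on_def)
  then have "\<not> ?c u - (\<Union>\<alpha>\<in>W n. N \<alpha>) \<subseteq> {\<gamma>}"
    using pos normal_ideal_subset[OF I] by blast
  then obtain \<gamma>' where \<gamma>': "\<gamma>' \<in> ?c u - (\<Union>\<alpha>\<in>W n. N \<alpha>)" "\<gamma>' \<noteq> \<gamma>"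
    by blast
  then have "S \<gamma> = S \<gamma>'"
    using S0 \<gamma> by blast
  then show False
    using S(1) \<gamma> \<gamma>' by (auto simp: cylinder_def inj_on_def)
qed

end

section \<open>Generic chains of sequences of conditions\<close>

text \<open>The order of the reduced power of the conditions modulo \<open>J\<close>; as in
  \<open>Col_le\<close>, the stronger side comes first.\<close>

definition le_mod :: "'a::wellorder \<Rightarrow> 'a set set \<Rightarrow> ('a \<Rightarrow> 'b \<rightharpoonup> 'c) \<Rightarrow> ('a \<Rightarrow> 'b \<rightharpoonup> 'c) \<Rightarrow> bool" where
  "le_mod \<kappa> J u v \<longleftrightarrow> {\<alpha>. \<alpha> < \<kappa> \<and> \<not> v \<alpha> \<subseteq>\<^sub>m u \<alpha>} \<in> J"

lemma le_mod_refl: "normal_ideal_on \<kappa> J \<Longrightarrow> le_mod \<kappa> J u u"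
  using normal_ideal_empty by (simp add: le_mod_def)

lemma le_mod_trans:
  assumes J: "normal_ideal_on \<kappa> J" and uv: "le_mod \<kappa> J u v" and vw: "le_mod \<kappa> J v w"
  shows "le_mod \<kappa> J u w"
  using normal_ideal_Un[OF J uv[unfolded le_mod_def] vw[unfolded le_mod_def]]
  unfolding le_mod_def by (rule normal_ideal_subset[OF J]) (auto intro: map_le_trans)

lemma le_mod_cong:
  assumes "\<And>\<alpha>. \<alpha> < \<kappa> \<Longrightarrow> u \<alpha> = u' \<alpha>" "\<And>\<alpha>. \<alpha> < \<kappa> \<Longrightarrow> v \<alpha> = v' \<alpha>"
  shows "le_mod \<kappa> J u v \<longleftrightarrow> le_mod \<kappa> J u' v'"
proof -
  have "{\<alpha>. \<alpha> < \<kappa> \<and> \<not> v \<alpha> \<subseteq>\<^sub>m u \<alpha>} = {\<alpha>. \<alpha> < \<kappa> \<and> \<not> v' \<alpha> \<subseteq>\<^sub>m u' \<alpha>}"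
    using assms by auto
  then show ?thesis
    by (simp add: le_mod_def)
qed

text \<open>At \<alpha> the bound only takes care of the indices below \<alpha>. Normality makes
  this enough: two of the sequences are incomparable only on a null set, the diagonal union of these
  sets is null, and so is the part up to \<beta>.\<close>

lemma le_mod_diagonal:
  assumes J: "normal_ideal_on \<kappa> J" and seg: "\<And>x. x < \<kappa> \<Longrightarrow> |{..<x}| <o |{..<\<kappa>}|"
    and comp: "\<And>\<beta> \<beta>'. \<beta> < \<kappa> \<Longrightarrow> \<beta>' < \<kappa> \<Longrightarrow> le_mod \<kappa> J (y \<beta>) (y \<beta>') \<or> le_mod \<kappa> J (y \<beta>') (y \<beta>)"
    and s: "\<And>\<alpha>. \<alpha> < \<kappa> \<Longrightarrow> \<forall>\<beta><\<alpha>. \<forall>\<beta>'<\<alpha>. y \<beta> \<alpha> \<subseteq>\<^sub>m y \<beta>' \<alpha> \<or> y \<beta>' \<alpha> \<subseteq>\<^sub>m y \<beta> \<alpha> \<Longrightarrow>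
      \<forall>\<beta><\<alpha>. y \<beta> \<alpha> \<subseteq>\<^sub>m s \<alpha>"
    and \<beta>: "\<beta> < \<kappa>"
  shows "le_mod \<kappa> J s (y \<beta>)"
proof -
  define bad where
    "bad \<beta> \<beta>' = {\<alpha>. \<alpha> < \<kappa> \<and> \<not> (y \<beta> \<alpha> \<subseteq>\<^sub>m y \<beta>' \<alpha> \<or> y \<beta>' \<alpha> \<subseteq>\<^sub>m y \<beta> \<alpha>)}" for \<beta> \<beta>'
  have "bad \<beta> \<beta>' \<in> J" if "\<beta> < \<kappa>" "\<beta>' < \<kappa>" for \<beta> \<beta>'
    using comp[OF that] unfolding le_mod_def bad_def by (auto intro: normal_ideal_subset[OF J])
  then have "(\<Union>\<beta>'\<in>{..<\<beta>}. bad \<beta> \<beta>') \<in> J" if "\<beta> < \<kappa>" for \<beta>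
    using that by (intro normal_ideal_UN[OF J seg]) auto
  then have B: "{\<alpha>. \<alpha> < \<kappa> \<and> (\<exists>\<beta><\<alpha>. \<alpha> \<in> (\<Union>\<beta>'\<in>{..<\<beta>}. bad \<beta> \<beta>'))} \<in> J" (is "?B \<in> J")
    by (rule normal_ideal_diagonal[OF J])
  have good: "y \<beta> \<alpha> \<subseteq>\<^sub>m s \<alpha>" if \<alpha>: "\<alpha> < \<kappa>" "\<alpha> \<notin> ?B" "\<beta> < \<alpha>" for \<alpha>
  proof -
    have "y \<eta> \<alpha> \<subseteq>\<^sub>m y \<eta>' \<alpha> \<or> y \<eta>' \<alpha> \<subseteq>\<^sub>m y \<eta> \<alpha>" if "\<eta> < \<alpha>" "\<eta>' < \<alpha>" for \<eta> \<eta>'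
      using that \<alpha>(1,2) unfolding bad_def by (cases \<eta> \<eta>' rule: linorder_cases) auto
    then have "\<forall>\<beta><\<alpha>. y \<beta> \<alpha> \<subseteq>\<^sub>m s \<alpha>"
      by (intro s[OF \<alpha>(1)]) simp
    then show ?thesis
      using \<alpha>(3) by simp
  qed
  have "{..<\<beta>} \<in> J"
    using \<beta> by (intro normal_ideal_small[OF J seg]) auto
  moreover have "{\<beta>} \<in> J"
    using J \<beta> by (auto simp: normal_ideal_on_def)
  ultimately have "{..<\<beta>} \<union> {\<beta>} \<in> J"
    by (rule normal_ideal_Un[OF J])
  with B have "?B \<union> ({..<\<beta>} \<union> {\<beta>}) \<in> J"
    by (rule normal_ideal_Un[OF J])
  then show ?thesis
    unfolding le_mod_def
  proof (rule normal_ideal_subset[OF J])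
    show "{\<alpha>. \<alpha> < \<kappa> \<and> \<not> y \<beta> \<alpha> \<subseteq>\<^sub>m s \<alpha>} \<subseteq> ?B \<union> ({..<\<beta>} \<union> {\<beta>})"
      using good by (metis (mono_tags, lifting) UnCI lessThan_iff linorder_neqE mem_Collect_eq singletonI subsetI)
  qed
qed

text \<open>A greedy descending subsequence of an arbitrary sequence: an index is kept when its
  value lies below all values kept before. Thus every sequence yields a chain.\<close>

function good :: "('b \<Rightarrow> 'b \<Rightarrow> bool) \<Rightarrow> ('a::wellorder \<Rightarrow> 'b) \<Rightarrow> 'a \<Rightarrow> bool" where
  "good le x \<beta> \<longleftrightarrow> (\<forall>\<eta><\<beta>. good le x \<eta> \<longrightarrow> le (x \<beta>) (x \<eta>))"
  by auto
termination
  by (relation "inv_image {(a, b). a < b} (\<lambda>(le, x, \<beta>). \<beta>)") (auto intro: wf_inv_image wf)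

declare good.simps [simp del]

lemma good_le: "good le x \<beta> \<Longrightarrow> good le x \<eta> \<Longrightarrow> \<eta> < \<beta> \<Longrightarrow> le (x \<beta>) (x \<eta>)"
  by (subst (asm) good.simps) blast

lemma good_cong: "(\<And>\<eta>. \<eta> \<le> \<beta> \<Longrightarrow> x \<eta> = x' \<eta>) \<Longrightarrow> good le x \<beta> = good le x' \<beta>"
proof (induction \<beta> rule: less_induct)
  case (less \<beta>)
  have "good le x \<eta> = good le x' \<eta>" if "\<eta> < \<beta>" for \<eta>
    using less.IH[OF that] less.prems that by (meson less_imp_le order_trans)
  then show ?case
    using less.prems by (subst (1 2) good.simps) auto
qed

section \<open>Lower bounds in the reduced power, generic chains and transfer\<close>

context omegas
begin

text \<open>The implication keeps the choice possible at exceptional \<alpha>, where the values do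
  not form a chain.\<close>

lemma pick_bound:
  assumes \<alpha>: "\<alpha> < (omega (Suc k) :: 'a)"
    and y: "\<And>\<beta>. \<beta> < \<alpha> \<Longrightarrow> y \<beta> \<alpha> \<in> Col (omega (Suc k) :: 'a) \<mu>"
  shows "\<exists>u\<in>Col (omega (Suc k)) \<mu>.
    (\<forall>\<beta><\<alpha>. \<forall>\<beta>'<\<alpha>. y \<beta> \<alpha> \<subseteq>\<^sub>m y \<beta>' \<alpha> \<or> y \<beta>' \<alpha> \<subseteq>\<^sub>m y \<beta> \<alpha>) \<longrightarrow> (\<forall>\<beta><\<alpha>. y \<beta> \<alpha> \<subseteq>\<^sub>m u)"
proof (cases "\<forall>\<beta><\<alpha>. \<forall>\<beta>'<\<alpha>. y \<beta> \<alpha> \<subseteq>\<^sub>m y \<beta>' \<alpha> \<or> y \<beta>' \<alpha> \<subseteq>\<^sub>m y \<beta> \<alpha>")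
  case True
  have "|(\<lambda>\<beta>. y \<beta> \<alpha>) ` {..<\<alpha>}| \<le>o |W k|"
    using segment_less[OF \<alpha>] less_Suc_iff card_of_image ordLeq_transitive by blast
  then have "\<exists>u\<in>Col (omega (Suc k)) \<mu>. (\<forall>p\<in>(\<lambda>\<beta>. y \<beta> \<alpha>) ` {..<\<alpha>}. p \<subseteq>\<^sub>m u) \<and>
      dom u = (\<Union>p\<in>(\<lambda>\<beta>. y \<beta> \<alpha>) ` {..<\<alpha>}. dom p)"
    using y True by (intro Col_chain_bound) auto
  then show ?thesis
    by auto
next
  case False
  then show ?thesis
    using Col_empty[OF infinite_W] by blast
qed

text \<open>The reduced power bounds chains one cardinal longer than \<open>Col_chain_bound\<close>
  does: enumerate the chain by \<open>omega (Suc k)\<close> and bound at each \<alpha> only the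
  members with earlier index.\<close>

lemma le_mod_chain_bound:
  fixes X :: "('a \<Rightarrow> 'a \<rightharpoonup> 'a) set"
  assumes J: "normal_ideal_on (omega (Suc k) :: 'a) J"
    and X: "\<And>x \<alpha>. x \<in> X \<Longrightarrow> \<alpha> < omega (Suc k) \<Longrightarrow> x \<alpha> \<in> Col (omega (Suc k)) \<mu>"
    and card: "|X| \<le>o |W (Suc k)|"
    and comp: "\<And>x x'. x \<in> X \<Longrightarrow> x' \<in> X \<Longrightarrow> le_mod (omega (Suc k)) J x x' \<or> le_mod (omega (Suc k)) J x' x"
  shows "\<exists>w\<in>W (Suc k) \<rightarrow>\<^sub>E Col (omega (Suc k)) \<mu>. \<forall>x\<in>X. le_mod (omega (Suc k)) J w x"
proof (cases "X = {}")
  case True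
  have "restrict (\<lambda>_. Map.empty) (W (Suc k)) \<in> W (Suc k) \<rightarrow>\<^sub>E Col (omega (Suc k)) \<mu>"
    using Col_empty[OF infinite_W] by auto
  then show ?thesis
    using True by blast
next
  case False
  then obtain y where y: "y ` W (Suc k) = X"
    using card card_of_ordLeq2 by metis
  have "\<exists>u\<in>Col (omega (Suc k)) \<mu>.
      (\<forall>\<beta><\<alpha>. \<forall>\<beta>'<\<alpha>. y \<beta> \<alpha> \<subseteq>\<^sub>m y \<beta>' \<alpha> \<or> y \<beta>' \<alpha> \<subseteq>\<^sub>m y \<beta> \<alpha>) \<longrightarrow> (\<forall>\<beta><\<alpha>. y \<beta> \<alpha> \<subseteq>\<^sub>m u)"
    if "\<alpha> < omega (Suc k)" for \<alpha>
    using that y by (intro pick_bound X) auto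
  then obtain w where w: "\<And>\<alpha>. \<alpha> < omega (Suc k) \<Longrightarrow> w \<alpha> \<in> Col (omega (Suc k)) \<mu> \<and>
      ((\<forall>\<beta><\<alpha>. \<forall>\<beta>'<\<alpha>. y \<beta> \<alpha> \<subseteq>\<^sub>m y \<beta>' \<alpha> \<or> y \<beta>' \<alpha> \<subseteq>\<^sub>m y \<beta> \<alpha>) \<longrightarrow> (\<forall>\<beta><\<alpha>. y \<beta> \<alpha> \<subseteq>\<^sub>m w \<alpha>))"
    by metis
  let ?w = "restrict w (W (Suc k))"
  have "le_mod (omega (Suc k)) J ?w (y \<beta>)" if "\<beta> < omega (Suc k)" for \<beta>
  proof (rule le_mod_diagonal[OF J segment_less _ _ that])
    show "le_mod (omega (Suc k)) J (y \<beta>) (y \<beta>') \<or> le_mod (omega (Suc k)) J (y \<beta>') (y \<beta>)"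
      if "\<beta> < omega (Suc k)" "\<beta>' < omega (Suc k)" for \<beta> \<beta>'
      using that y comp by blast
  qed (use w in auto)
  moreover have "?w \<in> W (Suc k) \<rightarrow>\<^sub>E Col (omega (Suc k)) \<mu>"
    using w by auto
  ultimately show ?thesis
    using y by blast
qed

text \<open>
  The functions \<open>g \<gamma>\<close> enumerate sequences of conditions, and their good elements form a chain.
  If each chain omitted some dense set, let \<open>D \<gamma>\<close> be the one omitted by the chain of \<open>g \<gamma>\<close>. Building
  conditions \<open>t \<alpha>\<close> in \<open>\<kappa>\<close> steps, one decides at step \<open>\<alpha>\<close> a member \<open>s \<alpha>\<close> of \<open>D \<gamma>\<close> below the diagonal
  of the earlier lower bounds \<open>w\<close>. The sequence \<open>s\<close> is then below the whole chain built so far, so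
  it may be appended.
\<close>

lemma generic_chain:
  fixes k :: nat
  defines "\<kappa> \<equiv> omega (Suc k) :: 'a" and "\<mu> \<equiv> omega (Suc (Suc k)) :: 'a"
    and "\<nu> \<equiv> omega (Suc (Suc (Suc k))) :: 'a"
  assumes J: "normal_ideal_on \<kappa> J" and G: "generic_family \<mu> \<nu> L g"
    and Q: "|Col \<kappa> \<mu>| \<le>o |{..<\<mu>}|" and T: "|{..<\<kappa>} \<rightarrow>\<^sub>E Col \<kappa> \<mu>| \<le>o |{..<\<nu>}|"
  shows "\<exists>C\<subseteq>{..<\<kappa>} \<rightarrow>\<^sub>E Col \<kappa> \<mu>. (\<forall>u\<in>C. \<forall>v\<in>C. le_mod \<kappa> J u v \<or> le_mod \<kappa> J v u) \<and>
    (\<forall>D\<subseteq>Col \<kappa> \<mu>. (\<forall>p\<in>Col \<kappa> \<mu>. \<exists>q\<in>D. p \<subseteq>\<^sub>m q) \<longrightarrow> (\<exists>u\<in>C. \<forall>\<alpha><\<kappa>. u \<alpha> \<in> D))"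
proof (rule ccontr)
  let ?Q = "Col \<kappa> \<mu>" and ?R = "Col \<mu> \<nu>" and ?T = "{..<\<kappa>} \<rightarrow>\<^sub>E Col \<kappa> \<mu>"
  let ?le = "le_mod \<kappa> J" and ?c = "cylinder \<nu> g"
  note L = generic_family_normal[OF G]
  define dense where "dense D \<longleftrightarrow> D \<subseteq> ?Q \<and> (\<forall>p\<in>?Q. \<exists>q\<in>D. p \<subseteq>\<^sub>m q)" for D
  have inf: "infinite {..<\<kappa>}" "infinite {..<\<mu>}" "infinite {..<\<nu>}"
    unfolding \<kappa>_def \<mu>_def \<nu>_def by (rule infinite_W)+
  have \<kappa>\<mu>: "|A| <o |{..<\<mu>}| \<longleftrightarrow> |A| \<le>o |{..<\<kappa>}|" for A :: "'z set"
    unfolding \<kappa>_def \<mu>_def by (rule less_Suc_iff)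
  have \<mu>\<nu>: "|A| <o |{..<\<nu>}| \<longleftrightarrow> |A| \<le>o |{..<\<mu>}|" for A :: "('a \<rightharpoonup> 'a) set"
    unfolding \<mu>_def \<nu>_def by (rule less_Suc_iff)
  assume contra: "\<not> ?thesis"
  have "\<exists>D. dense D \<and> (\<forall>u\<in>C. \<exists>\<alpha><\<kappa>. u \<alpha> \<notin> D)"
    if C: "C \<subseteq> ?T" "\<forall>u\<in>C. \<forall>v\<in>C. ?le u v \<or> ?le v u" for C
  proof (rule ccontr)
    assume "\<not> ?thesis"
    then have meet: "\<exists>u\<in>C. \<forall>\<alpha><\<kappa>. u \<alpha> \<in> D" if "dense D" for D
      using that by meson
    have "\<forall>D\<subseteq>?Q. (\<forall>p\<in>?Q. \<exists>q\<in>D. p \<subseteq>\<^sub>m q) \<longrightarrow> (\<exists>u\<in>C. \<forall>\<alpha><\<kappa>. u \<alpha> \<in> D)"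
      by (intro allI impI meet) (simp add: dense_def)
    then show False
      using contra C by (metis (no_types, lifting))
  qed
  then obtain Dc where Dc: "\<And>C. C \<subseteq> ?T \<Longrightarrow> (\<forall>u\<in>C. \<forall>v\<in>C. ?le u v \<or> ?le v u) \<Longrightarrow>
      dense (Dc C) \<and> (\<forall>u\<in>C. \<exists>\<alpha><\<kappa>. u \<alpha> \<notin> Dc C)"
    by metis
  have Tne: "restrict (\<lambda>_. Map.empty) {..<\<kappa>} \<in> ?T" (is "?e \<in> _")
    using Col_empty[OF inf(1)] by auto
  then have "?T \<noteq> {}"
    by blast
  then obtain d where d: "d ` {..<\<nu>} = ?T"
    using T card_of_ordLeq2 by metis
  \<comment> \<open>Ordinals below \<nu> code sequences of conditions. Nothing bounds the values of
    \<open>g \<gamma>\<close> by \<nu>, hence the default \<open>?e\<close>.\<close>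
  define dec where "dec x = (if x < \<nu> then d x else ?e)" for x
  have dec: "dec x \<in> ?T" for x
    using d Tne unfolding dec_def by (cases "x < \<nu>") auto
  have dec': "\<exists>x<\<nu>. dec x = u" if u: "u \<in> ?T" for u
  proof -
    have "u \<in> d ` {..<\<nu>}"
      using u d by simp
    then show ?thesis
      by (auto simp: dec_def)
  qed
  define x where "x \<gamma> \<beta> = dec (g \<gamma> \<beta>)" for \<gamma> \<beta>
  define C where "C \<gamma> = x \<gamma> ` {\<beta>. \<beta> < \<mu> \<and> good ?le (x \<gamma>) \<beta>}" for \<gamma>
  define D where "D \<gamma> = Dc (C \<gamma>)" for \<gamma>
  have good_chain: "?le (y \<eta>) (y \<eta>') \<or> ?le (y \<eta>') (y \<eta>)"
    if "good ?le y \<eta>" "good ?le y \<eta>'" for y and \<eta> \<eta>' :: 'a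
    using that good_le[of ?le y] le_mod_refl[OF J] by (cases \<eta> \<eta>' rule: linorder_cases) auto
  have CD: "dense (D \<gamma>)" "\<forall>u\<in>C \<gamma>. \<exists>\<alpha><\<kappa>. u \<alpha> \<notin> D \<gamma>" for \<gamma>
  proof -
    have "C \<gamma> \<subseteq> ?T"
      using dec by (auto simp: C_def x_def)
    moreover have "\<forall>u\<in>C \<gamma>. \<forall>v\<in>C \<gamma>. ?le u v \<or> ?le v u"
      using good_chain unfolding C_def by auto
    ultimately show "dense (D \<gamma>)" "\<forall>u\<in>C \<gamma>. \<exists>\<alpha><\<kappa>. u \<alpha> \<notin> D \<gamma>"
      using Dc unfolding D_def by blast+
  qed
  \<comment> \<open>The part of \<open>x \<gamma>\<close> that \<open>t\<close> already fixes: on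
    \<open>dom t\<close> both agree for every \<gamma> in the cylinder of \<open>t\<close>.\<close>
  define X where "X t \<eta> = dec (the (t \<eta>))" for t :: "'a \<rightharpoonup> 'a" and \<eta>
  have X_cyl: "x \<gamma> \<eta> = X t \<eta>" if "\<gamma> \<in> ?c t" "\<eta> \<in> dom t" for \<gamma> t \<eta>
  proof -
    have "t \<eta> = Some (g \<gamma> \<eta>)"
      using that unfolding cylinder_def by blast
    then show ?thesis
      by (simp add: x_def X_def)
  qed
  have X_mono: "X t \<eta> = X t' \<eta>" if "t \<subseteq>\<^sub>m t'" "\<eta> \<in> dom t" for t t' \<eta>
    using that unfolding X_def map_le_def by auto
  define w where "w t z = X t z" for t :: "'a \<rightharpoonup> 'a" and z
  \<comment> \<open>The domain is a closed initial segment with a good last index, so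
    \<open>w t z\<close> lies below every good sequence coded by \<open>t\<close>. Also,
    \<open>s\<close> is in \<open>D \<gamma>\<close> for almost all \<gamma> in the
    cylinder.\<close>
  define ok where "ok t z s \<longleftrightarrow> t \<in> ?R \<and> z < \<mu> \<and> dom t = {..z} \<and> good ?le (X t) z \<and> s \<in> ?Q \<and>
      ?c t - {\<gamma>. s \<in> D \<gamma>} \<in> L" for t z s
  define diag where "diag y \<alpha> s \<longleftrightarrow>
      ((\<forall>\<beta><\<alpha>. \<forall>\<beta>'<\<alpha>. y \<beta> \<alpha> \<subseteq>\<^sub>m y \<beta>' \<alpha> \<or> y \<beta>' \<alpha> \<subseteq>\<^sub>m y \<beta> \<alpha>) \<longrightarrow> (\<forall>\<beta><\<alpha>. y \<beta> \<alpha> \<subseteq>\<^sub>m s))"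
    for y :: "'a \<Rightarrow> 'a \<Rightarrow> 'a \<rightharpoonup> 'a" and \<alpha> s
  define step where "step f \<alpha> = (\<lambda>(t, z, s). ok t z s \<and> (\<forall>\<beta><\<alpha>. fst (f \<beta>) \<subseteq>\<^sub>m t) \<and>
      diag (\<lambda>\<beta>. w (fst (f \<beta>)) (fst (snd (f \<beta>)))) \<alpha> s)"
    for f :: "'a \<Rightarrow> ('a \<rightharpoonup> 'a) \<times> 'a \<times> ('a \<rightharpoonup> 'a)" and \<alpha>
  have Rbound: "\<exists>u\<in>?R. (\<forall>\<beta>\<in>A. t \<beta> \<subseteq>\<^sub>m u) \<and> dom u = (\<Union>\<beta>\<in>A. dom (t \<beta>))"
    if A: "|A| \<le>o |{..<\<kappa>}|" and t: "\<And>\<beta>. \<beta> \<in> A \<Longrightarrow> t \<beta> \<in> ?R"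
      "\<And>\<beta> \<beta>'. \<beta> \<in> A \<Longrightarrow> \<beta>' \<in> A \<Longrightarrow> \<beta> < \<beta>' \<Longrightarrow> t \<beta> \<subseteq>\<^sub>m t \<beta>'" for A :: "'a set" and t
  proof -
    have "p \<subseteq>\<^sub>m q \<or> q \<subseteq>\<^sub>m p" if "p \<in> t ` A" "q \<in> t ` A" for p q
      using that t(2) by (metis (no_types, lifting) image_iff linorder_neqE map_le_refl)
    moreover have "t ` A \<subseteq> ?R" "|t ` A| \<le>o |{..<\<kappa>}|"
      using t(1) A card_of_image ordLeq_transitive by blast+
    ultimately have "\<exists>u\<in>?R. (\<forall>p\<in>t ` A. p \<subseteq>\<^sub>m u) \<and> dom u = (\<Union>p\<in>t ` A. dom p)"
      unfolding \<kappa>_def \<mu>_def by (intro Col_chain_bound) auto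
    then show ?thesis
      by simp
  qed
  have extend: "\<exists>t z s. ok t z s \<and> u \<subseteq>\<^sub>m t \<and> b \<subseteq>\<^sub>m s" if u: "u \<in> ?R" and b: "b \<in> ?Q" for u b
  proof -
    define A where "A q = {\<gamma> \<in> ?c u. q \<in> D \<gamma>}" for q
    \<comment> \<open>The sets \<open>D \<gamma>\<close> are dense, so the \<open>A q\<close> with
      \<open>q\<close> extending \<open>b\<close> cover the cylinder of \<open>u\<close>. There are
      fewer than \<nu> of them, so one is positive.\<close>
    have "\<exists>q\<in>?Q. b \<subseteq>\<^sub>m q \<and> A q \<notin> L"
    proof (rule ccontr)
      assume "\<not> ?thesis"
      then have "(\<Union>q\<in>{q\<in>?Q. b \<subseteq>\<^sub>m q}. A q) \<in> L"
      proof (intro normal_ideal_UN[OF L])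
        have "|{q\<in>?Q. b \<subseteq>\<^sub>m q}| \<le>o |?Q|"
          by (rule card_of_mono1) blast
        then show "|{q\<in>?Q. b \<subseteq>\<^sub>m q}| <o |{..<\<nu>}|"
          using Q \<mu>\<nu> ordLeq_transitive by blast
      qed auto
      moreover have "?c u \<subseteq> (\<Union>q\<in>{q\<in>?Q. b \<subseteq>\<^sub>m q}. A q)"
      proof
        fix \<gamma> assume "\<gamma> \<in> ?c u"
        moreover obtain q where "q \<in> D \<gamma>" "b \<subseteq>\<^sub>m q" "q \<in> ?Q"
          using CD(1)[of \<gamma>] b unfolding dense_def by blast
        ultimately show "\<gamma> \<in> (\<Union>q\<in>{q\<in>?Q. b \<subseteq>\<^sub>m q}. A q)"
          by (auto simp: A_def)
      qed
      ultimately show False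
        using normal_ideal_subset[OF L] generic_family_positive[OF G u] by blast
    qed
    then obtain s where s: "s \<in> ?Q" "b \<subseteq>\<^sub>m s" "A s \<notin> L"
      by blast
    moreover have "A s \<subseteq> ?c u"
      by (auto simp: A_def)
    ultimately obtain t1 where t1: "t1 \<in> ?R" "u \<subseteq>\<^sub>m t1" "?c t1 - A s \<in> L"
      using generic_family_extend[OF G inf(2) u] by blast
    have "\<exists>z<\<mu>. dom t1 \<subseteq> {..<z}"
      using t1(1) \<kappa>\<mu> unfolding Col_def \<mu>_def \<kappa>_def by (intro bounded_in_Suc) auto
    then obtain z where z: "z < \<mu>" "dom t1 \<subseteq> {..<z}"
      by blast
    have zcard: "|{..<z}| <o |{..<\<mu>}|"
      using z(1) unfolding \<mu>_def by (rule segment_less)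
    obtain c0 where c0: "c0 < \<nu>"
      using inf(3) by (metis finite.emptyI lessThan_iff subsetI subset_empty)
    \<comment> \<open>Gaps are filled with an arbitrary code \<open>c0\<close>, since goodness of
      the next index depends on all earlier values.\<close>
    define t2 where "t2 \<eta> = (if \<eta> < z then Some (case t1 \<eta> of None \<Rightarrow> c0 | Some y \<Rightarrow> y) else None)" for \<eta>
    have dom2: "dom t2 = {..<z}"
      by (auto simp: t2_def split: if_splits)
    have t12: "t1 \<subseteq>\<^sub>m t2"
      using z(2) by (auto simp: t2_def map_le_def)
    have "ran t2 \<subseteq> insert c0 (ran t1)"
      by (auto simp: t2_def ran_def split: if_splits option.splits)
    then have "t2 \<in> ?R"
      using t1(1) c0 dom2 zcard z(1) by (auto simp: Col_def)
    \<comment> \<open>A lower bound of the good sequences coded so far, placed at index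
      \<open>z\<close>, makes \<open>z\<close> good.\<close>
    define Y where "Y = X t2 ` {\<eta>. \<eta> < z \<and> good ?le (X t2) \<eta>}"
    have "|Y| \<le>o |{..<z}|"
      unfolding Y_def using card_of_image card_of_mono1[of "{\<eta>. \<eta> < z \<and> good ?le (X t2) \<eta>}" "{..<z}"]
        ordLeq_transitive by blast
    then have "|Y| \<le>o |{..<\<kappa>}|"
      using zcard \<kappa>\<mu> ordLeq_transitive by blast
    moreover have "Y \<subseteq> ?T"
      using dec by (auto simp: Y_def X_def)
    moreover have "?le y y' \<or> ?le y' y" if "y \<in> Y" "y' \<in> Y" for y y'
      using that good_chain unfolding Y_def by auto
    ultimately have "\<exists>v\<in>?T. \<forall>y\<in>Y. ?le v y"
      using J unfolding \<kappa>_def by (intro le_mod_chain_bound) auto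
    then obtain v where v: "v \<in> ?T" "\<And>y. y \<in> Y \<Longrightarrow> ?le v y"
      by blast
    obtain c where c: "c < \<nu>" "dec c = v"
      using dec' v(1) by blast
    define t where "t = t2(z \<mapsto> c)"
    have "t \<in> ?R"
      unfolding t_def using Col_upd[OF \<open>t2 \<in> ?R\<close> z(1) c(1) inf(2)] .
    moreover have "dom t = {..z}"
      by (auto simp: t_def dom2)
    moreover have "good ?le (X t) z"
    proof -
      have eq: "X t \<eta> = X t2 \<eta>" if "\<eta> < z" for \<eta>
        using that by (auto simp: X_def t_def)
      have "?le (X t z) (X t \<eta>)" if "\<eta> < z" "good ?le (X t) \<eta>" for \<eta>
      proof -
        have "good ?le (X t2) \<eta>"
          using that good_cong[of \<eta> "X t" "X t2"] eq by auto
        then have "X t \<eta> \<in> Y"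
          using that eq by (auto simp: Y_def)
        moreover have "X t z = v"
          by (simp add: X_def t_def c(2))
        ultimately show ?thesis
          using v(2) by simp
      qed
      then show ?thesis
        by (subst good.simps) blast
    qed
    moreover have t2t: "t2 \<subseteq>\<^sub>m t"
      by (auto simp: t_def t2_def map_le_def)
    have "?c t - {\<gamma>. s \<in> D \<gamma>} \<in> L"
    proof (rule normal_ideal_subset[OF L t1(3)])
      have "?c t \<subseteq> ?c t1"
        using map_le_trans[OF t12 t2t] by (rule cylinder_antimono)
      then show "?c t - {\<gamma>. s \<in> D \<gamma>} \<subseteq> ?c t1 - A s"
        by (auto simp: A_def)
    qed
    ultimately have "ok t z s"
      using s(1) z(1) by (simp add: ok_def)
    then show ?thesis
      using map_le_trans[OF t1(2) map_le_trans[OF t12 t2t]] s(2) by blast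
  qed
  have "\<exists>f. \<forall>\<alpha>. \<alpha> < \<kappa> \<longrightarrow> step f \<alpha> (f \<alpha>)"
  proof (rule dependent_wellorder_choice)
    fix r and f f' :: "'a \<Rightarrow> ('a \<rightharpoonup> 'a) \<times> 'a \<times> ('a \<rightharpoonup> 'a)" and \<alpha> :: 'a
    assume "\<And>\<beta>. \<beta> < \<alpha> \<Longrightarrow> f \<beta> = f' \<beta>"
    then show "(\<alpha> < \<kappa> \<longrightarrow> step f \<alpha> r) = (\<alpha> < \<kappa> \<longrightarrow> step f' \<alpha> r)"
      unfolding step_def diag_def by (auto split: prod.splits)
  next
    fix \<alpha> :: 'a and f :: "'a \<Rightarrow> ('a \<rightharpoonup> 'a) \<times> 'a \<times> ('a \<rightharpoonup> 'a)"
    assume IH: "\<And>\<beta>. \<beta> < \<alpha> \<Longrightarrow> \<beta> < \<kappa> \<longrightarrow> step f \<beta> (f \<beta>)"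
    show "\<exists>r. \<alpha> < \<kappa> \<longrightarrow> step f \<alpha> r"
    proof (cases "\<alpha> < \<kappa>")
      case True
      have IH': "fst (f \<beta>) \<in> ?R \<and> (\<forall>\<eta><\<beta>. fst (f \<eta>) \<subseteq>\<^sub>m fst (f \<beta>))" if "\<beta> < \<alpha>" for \<beta>
        using IH[OF that] that True by (auto simp: step_def ok_def split: prod.splits)
      have "|{..<\<alpha>}| <o |{..<\<kappa>}|"
        using True unfolding \<kappa>_def by (rule segment_less)
      then obtain u where u: "u \<in> ?R" "\<forall>\<beta>\<in>{..<\<alpha>}. fst (f \<beta>) \<subseteq>\<^sub>m u"
        using Rbound[of "{..<\<alpha>}" "\<lambda>\<beta>. fst (f \<beta>)"] IH' ordLess_imp_ordLeq by (metis lessThan_iff)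
      have "w (fst (f \<beta>)) (fst (snd (f \<beta>))) \<alpha> \<in> ?Q" for \<beta>
        using dec True unfolding w_def X_def by auto
      then obtain b where b: "b \<in> ?Q" "diag (\<lambda>\<beta>. w (fst (f \<beta>)) (fst (snd (f \<beta>)))) \<alpha> b"
        using pick_bound[of \<alpha> k "\<lambda>\<beta>. w (fst (f \<beta>)) (fst (snd (f \<beta>)))" \<mu>] True
        unfolding diag_def \<kappa>_def by blast
      obtain t z s where tzs: "ok t z s" "u \<subseteq>\<^sub>m t" "b \<subseteq>\<^sub>m s"
        using extend[OF u(1) b(1)] by blast
      have "diag (\<lambda>\<beta>. w (fst (f \<beta>)) (fst (snd (f \<beta>)))) \<alpha> s"
        using b(2) tzs(3) map_le_trans unfolding diag_def by blast
      moreover have "\<forall>\<beta><\<alpha>. fst (f \<beta>) \<subseteq>\<^sub>m t"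
        using u(2) tzs(2) map_le_trans by blast
      ultimately have "step f \<alpha> (t, z, s)"
        using tzs(1) by (simp add: step_def)
      then show ?thesis
        by blast
    qed auto
  qed
  then obtain f where f: "\<And>\<alpha>. \<alpha> < \<kappa> \<Longrightarrow> step f \<alpha> (f \<alpha>)"
    by blast
  define t where "t \<alpha> = fst (f \<alpha>)" for \<alpha>
  define z where "z \<alpha> = fst (snd (f \<alpha>))" for \<alpha>
  define s where "s \<alpha> = snd (snd (f \<alpha>))" for \<alpha>
  have ok: "ok (t \<alpha>) (z \<alpha>) (s \<alpha>)" and tt: "\<And>\<beta>. \<beta> < \<alpha> \<Longrightarrow> t \<beta> \<subseteq>\<^sub>m t \<alpha>"
    and di: "diag (\<lambda>\<beta>. w (t \<beta>) (z \<beta>)) \<alpha> (s \<alpha>)" if "\<alpha> < \<kappa>" for \<alpha>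
    using f[OF that] unfolding step_def t_def z_def s_def by (auto split: prod.splits)
  \<comment> \<open>The last index of an earlier condition stays good in a later one, because
    goodness depends only on the values up to the index.\<close>
  have ww: "?le (w (t \<beta>') (z \<beta>')) (w (t \<beta>) (z \<beta>))" if "\<beta> < \<beta>'" "\<beta>' < \<kappa>" for \<beta> \<beta>'
  proof -
    have "\<beta> < \<kappa>"
      using that by simp
    note o1 = ok[OF this, unfolded ok_def] and o2 = ok[OF that(2), unfolded ok_def]
    have sub: "t \<beta> \<subseteq>\<^sub>m t \<beta>'"
      using tt that by blast
    then have "dom (t \<beta>) \<subseteq> dom (t \<beta>')"
      by (rule map_le_implies_dom_le)
    then have zz: "z \<beta> \<le> z \<beta>'"
      using o1 o2 by auto
    have X: "X (t \<beta>) \<eta> = X (t \<beta>') \<eta>" if "\<eta> \<le> z \<beta>" for \<eta>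
      using X_mono[OF sub] o1 that by auto
    show ?thesis
    proof (cases "z \<beta> = z \<beta>'")
      case True
      then show ?thesis
        using X[of "z \<beta>"] le_mod_refl[OF J] by (simp add: w_def)
    next
      case False
      have "good ?le (X (t \<beta>')) (z \<beta>)"
        using o1 good_cong[of "z \<beta>" "X (t \<beta>)" "X (t \<beta>')"] X by auto
      then show ?thesis
        unfolding w_def X[OF order_refl] using o2 False zz by (intro good_le[of ?le "X (t \<beta>')"]) auto
    qed
  qed
  have sw0: "?le s (w (t \<beta>) (z \<beta>))" if "\<beta> < \<kappa>" for \<beta>
  proof (rule le_mod_diagonal[OF J _ _ _ that, where y = "\<lambda>\<beta>. w (t \<beta>) (z \<beta>)"])
    show "|{..<x}| <o |{..<\<kappa>}|" if "x < \<kappa>" for x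
      using that unfolding \<kappa>_def by (rule segment_less)
    show "?le (w (t \<beta>) (z \<beta>)) (w (t \<beta>') (z \<beta>')) \<or> ?le (w (t \<beta>') (z \<beta>')) (w (t \<beta>) (z \<beta>))"
      if "\<beta> < \<kappa>" "\<beta>' < \<kappa>" for \<beta> \<beta>'
      using that ww le_mod_refl[OF J] by (cases \<beta> \<beta>' rule: linorder_cases) auto
    show "\<forall>\<beta><\<alpha>. w (t \<beta>) (z \<beta>) \<alpha> \<subseteq>\<^sub>m s \<alpha>" if "\<alpha> < \<kappa>"
      "\<forall>\<beta><\<alpha>. \<forall>\<beta>'<\<alpha>. w (t \<beta>) (z \<beta>) \<alpha> \<subseteq>\<^sub>m w (t \<beta>') (z \<beta>') \<alpha> \<or> w (t \<beta>') (z \<beta>') \<alpha> \<subseteq>\<^sub>m w (t \<beta>) (z \<beta>) \<alpha>" for \<alpha>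
      using di[OF that(1)] that(2) unfolding diag_def by blast
  qed
  define s' where "s' = restrict s {..<\<kappa>}"
  have sw: "?le s' (w (t \<beta>) (z \<beta>))" if "\<beta> < \<kappa>" for \<beta>
    using sw0[OF that] le_mod_cong[of \<kappa> s s'] by (simp add: s'_def)
  have "s' \<in> ?T"
    using ok by (auto simp: s'_def ok_def)
  then obtain c where c: "c < \<nu>" "dec c = s'"
    using dec' by blast
  obtain u where u: "u \<in> ?R" "\<forall>\<beta>\<in>{..<\<kappa>}. t \<beta> \<subseteq>\<^sub>m u" "dom u = (\<Union>\<beta>\<in>{..<\<kappa>}. dom (t \<beta>))"
    using Rbound[of "{..<\<kappa>}" t] ok tt ordIso_imp_ordLeq[OF card_of_refl] unfolding ok_def
    by (metis lessThan_iff)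
  have "\<not> {..<\<mu>} \<subseteq> dom u"
    using u(1) unfolding Col_def by (auto dest!: card_of_mono1 simp: not_ordLess_ordLeq)
  then obtain \<zeta>' where "\<zeta>' < \<mu>" "\<zeta>' \<notin> dom u"
    by auto
  \<comment> \<open>The first index left free by \<open>u\<close> receives the code of
    \<open>s'\<close>; by leastness every earlier index lies in some
    \<open>dom (t \<alpha>)\<close>.\<close>
  define \<zeta> where "\<zeta> = (LEAST \<zeta>. \<zeta> \<notin> dom u)"
  have \<zeta>: "\<zeta> \<notin> dom u" "\<zeta> < \<mu>" "\<And>\<eta>. \<eta> < \<zeta> \<Longrightarrow> \<eta> \<in> dom u"
    using LeastI[of "\<lambda>\<zeta>. \<zeta> \<notin> dom u" \<zeta>'] Least_le[of "\<lambda>\<zeta>. \<zeta> \<notin> dom u" \<zeta>'] \<open>\<zeta>' < \<mu>\<close> \<open>\<zeta>' \<notin> dom u\<close>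
      not_less_Least[of _ "\<lambda>\<zeta>. \<zeta> \<notin> dom u"]
    unfolding \<zeta>_def by (auto intro: le_less_trans)
  define tt' where "tt' = u(\<zeta> \<mapsto> c)"
  have tR: "tt' \<in> ?R"
    unfolding tt'_def using Col_upd[OF u(1) \<zeta>(2) c(1) inf(2)] .
  have ut: "u \<subseteq>\<^sub>m tt'"
    using \<zeta>(1) by (auto simp: tt'_def map_le_def)
  have tsub: "t \<alpha> \<subseteq>\<^sub>m tt'" if "\<alpha> < \<kappa>" for \<alpha>
    using u(2) ut that map_le_trans by blast
  \<comment> \<open>A good sequence before \<zeta> is coded by some \<open>t \<alpha>\<close>, so
    \<open>w (t \<alpha>) (z \<alpha>)\<close> lies below it and \<open>s'\<close> below that. Hence
    \<zeta> is good.\<close>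
  have inC: "s' \<in> C \<gamma>" if \<gamma>: "\<gamma> \<in> ?c tt'" for \<gamma>
  proof -
    have x\<zeta>: "x \<gamma> \<zeta> = s'"
      using X_cyl[OF \<gamma>, of \<zeta>] c(2) by (simp add: tt'_def X_def)
    have "?le s' (x \<gamma> \<eta>)" if \<eta>: "\<eta> < \<zeta>" "good ?le (x \<gamma>) \<eta>" for \<eta>
    proof -
      obtain \<alpha> where \<alpha>: "\<alpha> < \<kappa>" "\<eta> \<in> dom (t \<alpha>)"
        using \<zeta>(3)[OF \<eta>(1)] u(3) by auto
      note o = ok[OF \<alpha>(1), unfolded ok_def]
      have "\<gamma> \<in> ?c (t \<alpha>)"
        using \<gamma> cylinder_antimono[OF tsub[OF \<alpha>(1)]] by blast
      then have X: "x \<gamma> \<theta> = X (t \<alpha>) \<theta>" if "\<theta> \<le> z \<alpha>" for \<theta>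
        using X_cyl that o by simp
      have \<eta>z: "\<eta> \<le> z \<alpha>"
        using \<alpha>(2) o by simp
      have "?le (w (t \<alpha>) (z \<alpha>)) (x \<gamma> \<eta>)"
      proof (cases "\<eta> = z \<alpha>")
        case True
        then show ?thesis
          using X le_mod_refl[OF J] by (simp add: w_def)
      next
        case False
        have "good ?le (X (t \<alpha>)) \<eta>"
          using \<eta>(2) good_cong[of \<eta> "x \<gamma>" "X (t \<alpha>)"] X \<eta>z by (meson order_trans)
        then show ?thesis
          unfolding w_def X[OF \<eta>z] using o False \<eta>z by (intro good_le[of ?le "X (t \<alpha>)"]) auto
      qed
      then show ?thesis
        using sw[OF \<alpha>(1)] le_mod_trans[OF J] by blast
    qed
    then have "good ?le (x \<gamma>) \<zeta>"
      by (subst good.simps) (simp add: x\<zeta>)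
    then show ?thesis
      unfolding C_def using \<zeta>(2) x\<zeta> by force
  qed
  have "(\<Union>\<alpha>\<in>{..<\<kappa>}. ?c (t \<alpha>) - {\<gamma>. s \<alpha> \<in> D \<gamma>}) \<in> L"
  proof (rule normal_ideal_UN[OF L])
    have "|{..<\<kappa>}| <o |{..<\<mu>}|" "|{..<\<mu>}| <o |{..<\<nu>}|"
      unfolding \<kappa>_def \<mu>_def \<nu>_def by (rule W_less_Suc)+
    then show "|{..<\<kappa>}| <o |{..<\<nu>}|"
      using ordLess_transitive by blast
    show "?c (t \<alpha>) - {\<gamma>. s \<alpha> \<in> D \<gamma>} \<in> L" if "\<alpha> \<in> {..<\<kappa>}" for \<alpha>
      using ok that by (simp add: ok_def)
  qed
  \<comment> \<open>Some \<gamma> avoids all the exceptional sets. For it \<open>s'\<close> belongs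
    to \<open>C \<gamma>\<close> and takes all its values in \<open>D \<gamma>\<close>, which
    \<open>D \<gamma>\<close> was chosen to prevent.\<close>
  then have "\<not> ?c tt' \<subseteq> (\<Union>\<alpha>\<in>{..<\<kappa>}. ?c (t \<alpha>) - {\<gamma>. s \<alpha> \<in> D \<gamma>})"
    using generic_family_positive[OF G tR] normal_ideal_subset[OF L] by blast
  then obtain \<gamma> where \<gamma>: "\<gamma> \<in> ?c tt'" "\<And>\<alpha>. \<alpha> < \<kappa> \<Longrightarrow> \<gamma> \<notin> ?c (t \<alpha>) - {\<gamma>. s \<alpha> \<in> D \<gamma>}"
    by auto
  have "s' \<alpha> \<in> D \<gamma>" if "\<alpha> < \<kappa>" for \<alpha>
    using \<gamma> that cylinder_antimono[OF tsub[OF that]] by (auto simp: s'_def)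
  then show False
    using CD(2) inC[OF \<gamma>(1)] by blast
qed

text \<open>The conditions deciding the value of \<open>f\<close> modulo \<open>I\<close> are dense,
  as \<open>f\<close> has fewer than \<mu> values. The chain contains a sequence of such conditions,
  and \<open>\<Psi> f\<close> lists the decided values. Agreement of \<open>\<Psi> f\<close> and
  \<open>\<Psi> f'\<close> on a \<open>J\<close>-positive set gives an \<alpha> with equal decided
  values and comparable conditions; almost everywhere on the cylinder of the stronger one,
  \<open>f\<close> and \<open>f'\<close> agree.\<close>

lemma ideal_transfer:
  fixes k :: nat
  defines "\<kappa> \<equiv> omega (Suc k) :: 'a" and "\<mu> \<equiv> omega (Suc (Suc k)) :: 'a"
    and "\<nu> \<equiv> omega (Suc (Suc (Suc k))) :: 'a"
  assumes J: "normal_ideal_on \<kappa> J" and H: "generic_family \<kappa> \<mu> I h" and G: "generic_family \<mu> \<nu> L g"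
    and Q: "|Col \<kappa> \<mu>| \<le>o |{..<\<mu>}|" and T: "|{..<\<kappa>} \<rightarrow>\<^sub>E Col \<kappa> \<mu>| \<le>o |{..<\<nu>}|"
    and l: "|{..<l}| \<le>o |{..<\<kappa>}|"
  shows "\<exists>\<Psi>. \<forall>f\<in>{..<\<mu>} \<rightarrow> {..<l}. \<Psi> f \<in> {..<\<kappa>} \<rightarrow>\<^sub>E {..<l} \<and>
    (\<forall>f'\<in>{..<\<mu>} \<rightarrow> {..<l}. {\<alpha>. \<alpha> < \<kappa> \<and> \<Psi> f \<alpha> = \<Psi> f' \<alpha>} \<notin> J \<longrightarrow> {\<gamma>. \<gamma> < \<mu> \<and> f \<gamma> = f' \<gamma>} \<notin> I)"
proof -
  let ?Q = "Col \<kappa> \<mu>" and ?c = "cylinder \<mu> h"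
  note I = generic_family_normal[OF H]
  have inf: "infinite {..<\<kappa>}"
    unfolding \<kappa>_def by (rule infinite_W)
  have l': "|{..<l}| <o |{..<\<mu>}|"
    using l less_Suc_iff unfolding \<kappa>_def \<mu>_def by blast
  obtain C where CT: "C \<subseteq> {..<\<kappa>} \<rightarrow>\<^sub>E ?Q"
    and chain: "\<And>u v. u \<in> C \<Longrightarrow> v \<in> C \<Longrightarrow> le_mod \<kappa> J u v \<or> le_mod \<kappa> J v u"
    and meet: "\<And>D. D \<subseteq> ?Q \<Longrightarrow> (\<forall>p\<in>?Q. \<exists>q\<in>D. p \<subseteq>\<^sub>m q) \<Longrightarrow> \<exists>u\<in>C. \<forall>\<alpha><\<kappa>. u \<alpha> \<in> D"
    using generic_chain[OF J[unfolded \<kappa>_def] G[unfolded \<mu>_def \<nu>_def] Q[unfolded \<kappa>_def \<mu>_def]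
        T[unfolded \<kappa>_def \<mu>_def \<nu>_def]] unfolding \<kappa>_def \<mu>_def by auto
  define D where "D f = {p\<in>?Q. \<exists>i<l. ?c p - {\<gamma>. f \<gamma> = i} \<in> I}" for f
  have "\<exists>u\<in>C. \<forall>\<alpha><\<kappa>. u \<alpha> \<in> D f" if f: "f \<in> {..<\<mu>} \<rightarrow> {..<l}" for f
  proof (rule meet)
    show "D f \<subseteq> ?Q"
      by (auto simp: D_def)
    show "\<forall>p\<in>?Q. \<exists>q\<in>D f. p \<subseteq>\<^sub>m q"
    proof
      fix p assume p: "p \<in> ?Q"
      have "\<exists>i<l. ?c p \<inter> {\<gamma>. f \<gamma> = i} \<notin> I"
      proof (rule ccontr)
        assume "\<not> ?thesis"
        then have "(\<Union>i\<in>{..<l}. ?c p \<inter> {\<gamma>. f \<gamma> = i}) \<in> I"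
          by (intro normal_ideal_UN[OF I l']) auto
        moreover have "?c p \<subseteq> (\<Union>i\<in>{..<l}. ?c p \<inter> {\<gamma>. f \<gamma> = i})"
          using f by (auto simp: cylinder_def)
        ultimately show False
          using generic_family_positive[OF H p] normal_ideal_subset[OF I] by blast
      qed
      then obtain i where i: "i < l" "?c p \<inter> {\<gamma>. f \<gamma> = i} \<notin> I"
        by blast
      then obtain q where q: "q \<in> ?Q" "p \<subseteq>\<^sub>m q" "?c q - (?c p \<inter> {\<gamma>. f \<gamma> = i}) \<in> I"
        using generic_family_extend[OF H inf p, of "?c p \<inter> {\<gamma>. f \<gamma> = i}"] by auto
      have "?c q - {\<gamma>. f \<gamma> = i} \<in> I"
        by (rule normal_ideal_subset[OF I q(3)]) blast
      then show "\<exists>q\<in>D f. p \<subseteq>\<^sub>m q"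
        using q(1,2) i(1) by (auto simp: D_def)
    qed
  qed
  then obtain u where u: "\<And>f. f \<in> {..<\<mu>} \<rightarrow> {..<l} \<Longrightarrow> u f \<in> C \<and> (\<forall>\<alpha><\<kappa>. u f \<alpha> \<in> D f)"
    by metis
  define \<psi> where "\<psi> f \<alpha> = (SOME i. i < l \<and> ?c (u f \<alpha>) - {\<gamma>. f \<gamma> = i} \<in> I)" for f \<alpha>
  have \<psi>: "\<psi> f \<alpha> < l \<and> ?c (u f \<alpha>) - {\<gamma>. f \<gamma> = \<psi> f \<alpha>} \<in> I"
    if "f \<in> {..<\<mu>} \<rightarrow> {..<l}" "\<alpha> < \<kappa>" for f \<alpha>
  proof -
    have "\<exists>i. i < l \<and> ?c (u f \<alpha>) - {\<gamma>. f \<gamma> = i} \<in> I"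
      using u[OF that(1)] that(2) by (auto simp: D_def)
    then show ?thesis
      unfolding \<psi>_def by (rule someI_ex)
  qed
  have agree: "{\<gamma>. \<gamma> < \<mu> \<and> f \<gamma> = f' \<gamma>} \<notin> I"
    if f: "f \<in> {..<\<mu>} \<rightarrow> {..<l}" and f': "f' \<in> {..<\<mu>} \<rightarrow> {..<l}"
      and \<alpha>: "\<alpha> < \<kappa>" "\<psi> f \<alpha> = \<psi> f' \<alpha>" "u f \<alpha> \<subseteq>\<^sub>m u f' \<alpha>" for f f' \<alpha>
  proof
    assume A: "{\<gamma>. \<gamma> < \<mu> \<and> f \<gamma> = f' \<gamma>} \<in> I"
    have "?c (u f' \<alpha>) \<subseteq> ?c (u f \<alpha>)"
      using \<alpha>(3) by (rule cylinder_antimono)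
    moreover have "(?c (u f \<alpha>) - {\<gamma>. f \<gamma> = \<psi> f \<alpha>}) \<union> ((?c (u f' \<alpha>) - {\<gamma>. f' \<gamma> = \<psi> f \<alpha>}) \<union>
        {\<gamma>. \<gamma> < \<mu> \<and> f \<gamma> = f' \<gamma>}) \<in> I" (is "?U \<in> I")
      using \<psi>[OF f \<alpha>(1)] \<psi>[OF f' \<alpha>(1)] A \<alpha>(2) by (intro normal_ideal_Un[OF I]) auto
    moreover have "?c (u f' \<alpha>) \<subseteq> {..<\<mu>}"
      by (auto simp: cylinder_def)
    ultimately have "?c (u f' \<alpha>) \<in> I"
      by (intro normal_ideal_subset[OF I \<open>?U \<in> I\<close>]) auto
    moreover have "u f' \<alpha> \<in> ?Q"
      using u[OF f'] \<alpha>(1) by (auto simp: D_def)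
    ultimately show False
      using generic_family_positive[OF H] by blast
  qed
  show ?thesis
  proof (intro exI[of _ "\<lambda>f. restrict (\<psi> f) {..<\<kappa>}"] ballI conjI impI)
    show "restrict (\<psi> f) {..<\<kappa>} \<in> {..<\<kappa>} \<rightarrow>\<^sub>E {..<l}" if "f \<in> {..<\<mu>} \<rightarrow> {..<l}" for f
      using \<psi>[OF that] by auto
  next
    fix f f'
    assume f: "f \<in> {..<\<mu>} \<rightarrow> {..<l}" and f': "f' \<in> {..<\<mu>} \<rightarrow> {..<l}"
      and pos: "{\<alpha>. \<alpha> < \<kappa> \<and> restrict (\<psi> f) {..<\<kappa>} \<alpha> = restrict (\<psi> f') {..<\<kappa>} \<alpha>} \<notin> J" (is "?E \<notin> J")
    have "{\<alpha>. \<alpha> < \<kappa> \<and> \<not> (u f \<alpha> \<subseteq>\<^sub>m u f' \<alpha> \<or> u f' \<alpha> \<subseteq>\<^sub>m u f \<alpha>)} \<in> J" (is "?N \<in> J")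
    proof -
      have "le_mod \<kappa> J (u f) (u f') \<or> le_mod \<kappa> J (u f') (u f)"
        using chain u f f' by blast
      then show ?thesis
        unfolding le_mod_def by (elim disjE) (erule normal_ideal_subset[OF J], blast)+
    qed
    then have "?E - ?N \<notin> J"
      using positive_Diff[OF J pos] by blast
    then have "?E - ?N \<noteq> {}"
      by (rule contrapos_nn) (simp only: normal_ideal_empty[OF J])
    then obtain \<alpha> where \<alpha>: "\<alpha> \<in> ?E - ?N"
      unfolding ex_in_conv[symmetric] by (rule exE)
    have sym: "{\<gamma>. \<gamma> < \<mu> \<and> f' \<gamma> = f \<gamma>} = {\<gamma>. \<gamma> < \<mu> \<and> f \<gamma> = f' \<gamma>}"
      by auto
    have \<alpha>': "\<alpha> < \<kappa>" "\<psi> f \<alpha> = \<psi> f' \<alpha>" "u f \<alpha> \<subseteq>\<^sub>m u f' \<alpha> \<or> u f' \<alpha> \<subseteq>\<^sub>m u f \<alpha>"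
      using \<alpha> by auto
    from \<alpha>'(3) show "{\<gamma>. \<gamma> < \<mu> \<and> f \<gamma> = f' \<gamma>} \<notin> I"
    proof
      assume "u f \<alpha> \<subseteq>\<^sub>m u f' \<alpha>"
      then show ?thesis
        by (rule agree[OF f f' \<alpha>'(1,2)])
    next
      assume "u f' \<alpha> \<subseteq>\<^sub>m u f \<alpha>"
      then show ?thesis
        using agree[OF f' f \<alpha>'(1) \<alpha>'(2)[symmetric]] sym by simp
    qed
  qed
qed

end

section \<open>Colorings of the Erdos-Hajnal graphs\<close>

lemma card_of_Pow_mono_ordLeq: "|A| \<le>o |B| \<Longrightarrow> |Pow A| \<le>o |Pow B|"
  unfolding card_of_ordLeq[symmetric] by (metis inj_on_image_Pow image_Pow_mono)

lemma EH_edge_iff: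
  assumes "infinite {..<\<kappa>}"
  shows "{f, g} \<in> snd (EH \<kappa> \<mu>) \<longleftrightarrow> f \<in> {..<\<kappa>} \<rightarrow>\<^sub>E {..<\<mu>} \<and> g \<in> {..<\<kappa>} \<rightarrow>\<^sub>E {..<\<mu>} \<and>
    |{\<alpha>. \<alpha> < \<kappa> \<and> f \<alpha> = g \<alpha>}| <o |{..<\<kappa>}|"
proof -
  have ne: "f \<noteq> g" if "|{\<alpha>. \<alpha> < \<kappa> \<and> f \<alpha> = g \<alpha>}| <o |{..<\<kappa>}|" for f g :: "'a \<Rightarrow> 'a"
  proof
    assume "f = g"
    then have "{\<alpha>. \<alpha> < \<kappa> \<and> f \<alpha> = g \<alpha>} = {..<\<kappa>}"
      by auto
    with that show False
      using ordLess_irreflexive by metis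
  qed
  have sym: "{\<alpha>. \<alpha> < \<kappa> \<and> f \<alpha> = g \<alpha>} = {\<alpha>. \<alpha> < \<kappa> \<and> g \<alpha> = f \<alpha>}" for f g :: "'a \<Rightarrow> 'a"
    by auto
  show ?thesis (is "?L \<longleftrightarrow> ?R")
  proof
    assume ?L
    then obtain f' g' where f'g': "{f, g} = {f', g'}" "f' \<in> {..<\<kappa>} \<rightarrow>\<^sub>E {..<\<mu>}"
        "g' \<in> {..<\<kappa>} \<rightarrow>\<^sub>E {..<\<mu>}" "|{\<alpha>. \<alpha> < \<kappa> \<and> f' \<alpha> = g' \<alpha>}| <o |{..<\<kappa>}|"
      unfolding EH_def Let_def snd_conv mem_Collect_eq by (elim exE conjE)
    from f'g'(1) have "f = f' \<and> g = g' \<or> f = g' \<and> g = f'"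
      by (simp add: doubleton_eq_iff)
    then show ?R
      using f'g'(2-4) sym[of f' g'] by (elim disjE conjE) simp_all
  next
    assume ?R
    then show ?L
      unfolding EH_def Let_def snd_conv mem_Collect_eq
      by (intro exI[of _ f] exI[of _ g]) (simp add: ne)
  qed
qed

lemma EH_vertices: "fst (EH \<kappa> \<mu>) = {..<\<kappa>} \<rightarrow>\<^sub>E {..<\<mu>}"
  by (simp add: EH_def Let_def)

text \<open>At \<alpha> the function \<open>g\<close> avoids the representatives of all colors below
  \<alpha>. So it agrees with the representative of its own color \<open>i\<close> only up to
  \<open>i\<close>, which is an edge between vertices of equal color.\<close>

lemma EH_same_not_colorable:
  fixes \<kappa> :: "'a::wellorder"
  assumes inf: "infinite {..<\<kappa>}" and seg: "\<And>x. x < \<kappa> \<Longrightarrow> |{..<x}| <o |{..<\<kappa>}|"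
  shows "\<not> vertex_coloring (EH \<kappa> \<kappa>) {..<\<kappa>} c"
proof
  let ?V = "{..<\<kappa>} \<rightarrow>\<^sub>E {..<\<kappa>}"
  assume c: "vertex_coloring (EH \<kappa> \<kappa>) {..<\<kappa>} c"
  define rep where "rep i = (SOME f. f \<in> ?V \<and> c f = i)" for i
  have "\<exists>y<\<kappa>. \<forall>i<\<alpha>. y \<noteq> rep i \<alpha>" if "\<alpha> < \<kappa>" for \<alpha>
  proof -
    have "|(\<lambda>i. rep i \<alpha>) ` {..<\<alpha>}| <o |{..<\<kappa>}|"
      using card_of_image seg[OF that] ordLeq_ordLess_trans by blast
    then have "\<not> {..<\<kappa>} \<subseteq> (\<lambda>i. rep i \<alpha>) ` {..<\<alpha>}"
      using card_of_mono1 not_ordLess_ordLeq by blast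
    then show ?thesis
      by auto
  qed
  then obtain y where y: "\<And>\<alpha>. \<alpha> < \<kappa> \<Longrightarrow> y \<alpha> < \<kappa> \<and> (\<forall>i<\<alpha>. y \<alpha> \<noteq> rep i \<alpha>)"
    by metis
  define g where "g = restrict y {..<\<kappa>}"
  have g: "g \<in> ?V"
    using y by (auto simp: g_def)
  define i where "i = c g"
  have i: "i < \<kappa>"
    using c g by (auto simp: i_def vertex_coloring_def EH_vertices)
  have rep: "rep i \<in> ?V \<and> c (rep i) = i"
    unfolding rep_def using g i_def by (intro someI[of "\<lambda>f. f \<in> ?V \<and> c f = i" g]) simp
  have "{\<alpha>. \<alpha> < \<kappa> \<and> g \<alpha> = rep i \<alpha>} \<subseteq> {..<i} \<union> {i}"
  proof
    fix \<alpha> assume "\<alpha> \<in> {\<alpha>. \<alpha> < \<kappa> \<and> g \<alpha> = rep i \<alpha>}"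
    then have "\<not> i < \<alpha>"
      using y by (auto simp: g_def)
    then show "\<alpha> \<in> {..<i} \<union> {i}"
      by auto
  qed
  moreover have "|{..<i} \<union> {i}| <o |{..<\<kappa>}|"
    using seg[OF i] inf by (intro card_of_Un_ordLess_infinite) (auto simp: finite_ordLess_infinite_set)
  ultimately have "|{\<alpha>. \<alpha> < \<kappa> \<and> g \<alpha> = rep i \<alpha>}| <o |{..<\<kappa>}|"
    using card_of_mono1 ordLeq_ordLess_trans by blast
  then have "c g \<noteq> c (rep i)"
    using c g rep unfolding vertex_coloring_def EH_vertices using EH_edge_iff[OF inf] by blast
  then show False
    using rep i_def by simp
qed

text \<open>
  This is the argument that the line digraph of a digraph with more than \<open>2\<^sup>\<lambda>\<close> colors needs more
  than \<open>\<lambda>\<close> colors. Coding values as subsets of \<open>\<lambda>\<close>, the arc from \<open>f\<close> to \<open>g\<close> becomes a function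
  into \<open>\<lambda>\<close> that records at each point an element separating the two values, with its side.
\<close>

lemma EH_colorable_Pow:
  fixes \<kappa> l l' :: "'a::wellorder"
  assumes inf: "infinite {..<\<kappa>}" "infinite {..<l}"
    and le: "|{..<l'}| \<le>o |Pow {..<l}|" and ge: "|Pow {..<l}| \<le>o |{..<l'}|"
    and c: "vertex_coloring (EH \<kappa> l) {..<l} c"
  shows "\<exists>c'. vertex_coloring (EH \<kappa> l') {..<l'} c'"
proof -
  let ?V = "{..<\<kappa>} \<rightarrow>\<^sub>E {..<l}" and ?V' = "{..<\<kappa>} \<rightarrow>\<^sub>E {..<l'}"
  define E where "E f g \<longleftrightarrow> |{\<alpha>. \<alpha> < \<kappa> \<and> f \<alpha> = g \<alpha>}| <o |{..<\<kappa>}|" for f g :: "'a \<Rightarrow> 'a"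
  obtain a where a: "inj_on a {..<l'}" "a ` {..<l'} \<subseteq> Pow {..<l}"
    using le unfolding card_of_ordLeq[symmetric] by blast
  obtain d where d: "inj_on d (Pow {..<l})" "d ` Pow {..<l} \<subseteq> {..<l'}"
    using ge unfolding card_of_ordLeq[symmetric] by blast
  have "|{..<l} \<times> (UNIV :: bool set)| \<le>o |{..<l}|"
    using inf(2) by (intro card_of_Sigma_ordLeq_infinite)
      (auto simp: ordIso_imp_ordLeq[OF card_of_refl] finite_ordLess_infinite_set ordLess_imp_ordLeq)
  then obtain b where b: "inj_on b ({..<l} \<times> (UNIV :: bool set))"
      "b ` ({..<l} \<times> (UNIV :: bool set)) \<subseteq> {..<l}"
    unfolding card_of_ordLeq[symmetric] by blast
  obtain e0 where e0: "e0 < l"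
    using inf(2) by (metis finite.emptyI lessThan_iff subsetI subset_empty)
  \<comment> \<open>The Boolean tells on which side the separating element lies; for equal values
    \<open>(e0, True)\<close> is a dummy.\<close>
  have "\<exists>s. fst s < l \<and> (x \<noteq> y \<longrightarrow> (if snd s then fst s \<in> a x - a y else fst s \<in> a y - a x))"
    if "x < l'" "y < l'" for x y
  proof (cases "x = y")
    case True
    then show ?thesis
      using e0 by (intro exI[of _ "(e0, True)"]) auto
  next
    case False
    then have "a x \<noteq> a y"
      using a(1) that by (auto dest: inj_onD)
    then obtain \<xi> where \<xi>: "\<xi> \<in> a x - a y \<or> \<xi> \<in> a y - a x"
      by blast
    then have "\<xi> < l"
      using a(2) that by blast
    then show ?thesis
      using \<xi> by (intro exI[of _ "(\<xi>, \<xi> \<in> a x)"]) auto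
  qed
  then obtain sep where sep: "\<And>x y. x < l' \<Longrightarrow> y < l' \<Longrightarrow> fst (sep x y) < l \<and> (x \<noteq> y \<longrightarrow>
      (if snd (sep x y) then fst (sep x y) \<in> a x - a y else fst (sep x y) \<in> a y - a x))"
    by metis
  define h where "h f g = restrict (\<lambda>\<alpha>. b (sep (f \<alpha>) (g \<alpha>))) {..<\<kappa>}" for f g
  have h: "h f g \<in> ?V" if "f \<in> ?V'" "g \<in> ?V'" for f g
  proof -
    have "b (sep (f \<alpha>) (g \<alpha>)) < l" if "\<alpha> < \<kappa>" for \<alpha>
    proof -
      have "f \<alpha> < l'" "g \<alpha> < l'"
        using that \<open>f \<in> ?V'\<close> \<open>g \<in> ?V'\<close> by auto
      then have "sep (f \<alpha>) (g \<alpha>) \<in> {..<l} \<times> UNIV"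
        using sep by (simp add: mem_Times_iff)
      then show ?thesis
        using imageI[of _ _ b] b(2) by (metis lessThan_iff subsetD)
    qed
    then show ?thesis
      by (auto simp: h_def)
  qed
  have arc: "c (h f g) \<noteq> c (h g k)"
    if V: "f \<in> ?V'" "g \<in> ?V'" "k \<in> ?V'" and "E f g" "E g k" for f g k
  proof -
    have "{\<alpha>. \<alpha> < \<kappa> \<and> h f g \<alpha> = h g k \<alpha>} \<subseteq>
        {\<alpha>. \<alpha> < \<kappa> \<and> f \<alpha> = g \<alpha>} \<union> {\<alpha>. \<alpha> < \<kappa> \<and> g \<alpha> = k \<alpha>}"
    proof
      fix \<alpha> assume "\<alpha> \<in> {\<alpha>. \<alpha> < \<kappa> \<and> h f g \<alpha> = h g k \<alpha>}"
      then have \<alpha>: "\<alpha> < \<kappa>" "b (sep (f \<alpha>) (g \<alpha>)) = b (sep (g \<alpha>) (k \<alpha>))"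
        by (auto simp: h_def)
      have l': "f \<alpha> < l'" "g \<alpha> < l'" "k \<alpha> < l'"
        using V \<alpha>(1) by auto
      have "sep (f \<alpha>) (g \<alpha>) = sep (g \<alpha>) (k \<alpha>)"
        using \<alpha>(2) sep l' by (intro inj_onD[OF b(1)]) (auto simp: mem_Times_iff)
      \<comment> \<open>Otherwise the common element, with its common side, would be both in and
        outside \<open>a (g \<alpha>)\<close>.\<close>
      then have "f \<alpha> = g \<alpha> \<or> g \<alpha> = k \<alpha>"
        using sep[OF l'(1,2)] sep[OF l'(2,3)] by (auto split: if_splits)
      then show "\<alpha> \<in> {\<alpha>. \<alpha> < \<kappa> \<and> f \<alpha> = g \<alpha>} \<union> {\<alpha>. \<alpha> < \<kappa> \<and> g \<alpha> = k \<alpha>}"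
        using \<alpha>(1) by auto
    qed
    moreover have "|{\<alpha>. \<alpha> < \<kappa> \<and> f \<alpha> = g \<alpha>} \<union> {\<alpha>. \<alpha> < \<kappa> \<and> g \<alpha> = k \<alpha>}| <o |{..<\<kappa>}|"
      using that inf(1) unfolding E_def by (intro card_of_Un_ordLess_infinite)
    ultimately have "|{\<alpha>. \<alpha> < \<kappa> \<and> h f g \<alpha> = h g k \<alpha>}| <o |{..<\<kappa>}|"
      using card_of_mono1 ordLeq_ordLess_trans by blast
    then have "{h f g, h g k} \<in> snd (EH \<kappa> l)"
      using h[OF V(1,2)] h[OF V(2,3)] by (simp add: EH_edge_iff[OF inf(1)])
    then show ?thesis
      using c h[OF V(1,2)] h[OF V(2,3)] by (simp add: vertex_coloring_def EH_vertices)
  qed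
  \<comment> \<open>The colors of the arcs leaving \<open>f\<close>. The color of an arc from
    \<open>f\<close> to \<open>g\<close> is in \<open>C f\<close> but, by \<open>arc\<close>, not in
    \<open>C g\<close>.\<close>
  define C where "C f = {c (h f g) | g. g \<in> ?V' \<and> E f g}" for f
  have C: "C f \<in> Pow {..<l}" if "f \<in> ?V'" for f
    using funcset_mem[of c ?V] c h[OF that] by (auto simp: C_def vertex_coloring_def EH_vertices)
  have "C f \<noteq> C g" if fg: "f \<in> ?V'" "g \<in> ?V'" "E f g" for f g
  proof
    assume "C f = C g"
    moreover have "c (h f g) \<in> C f"
      using fg by (auto simp: C_def)
    ultimately obtain k where "k \<in> ?V'" "E g k" "c (h f g) = c (h g k)"
      by (auto simp: C_def)
    then show False
      using arc fg by blast
  qed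
  then have "d (C f) \<noteq> d (C g)" if "f \<in> ?V'" "g \<in> ?V'" "E f g" for f g
    using that inj_onD[OF d(1) _ C C] by metis
  then have "vertex_coloring (EH \<kappa> l') {..<l'} (\<lambda>f. d (C f))"
    unfolding vertex_coloring_def EH_vertices
  proof (intro conjI ballI impI Pi_I)
    show "d (C f) \<in> {..<l'}" if "f \<in> ?V'" for f
      using C[OF that] by (intro subsetD[OF d(2)] imageI)
    show "d (C f) \<noteq> d (C g)" if "f \<in> ?V'" "g \<in> ?V'" "{f, g} \<in> snd (EH \<kappa> l')" for f g
      using that \<open>\<And>g f. f \<in> ?V' \<Longrightarrow> g \<in> ?V' \<Longrightarrow> E f g \<Longrightarrow> d (C f) \<noteq> d (C g)\<close>
      by (simp add: EH_edge_iff[OF inf(1)] E_def)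
  qed
  then show ?thesis
    by blast
qed

section \<open>Counting conditions, and the two bounds on the chromatic number\<close>

context omegas
begin

text \<open>By regularity the range of a condition lies below some \<open>z\<close>, so its graph is
  a subset of \<open>W n \<times> {..<z}\<close>, a set of size at most
  \<open>omega n\<close>.\<close>

lemma card_Col:
  assumes "|Pow (W n)| \<le>o |W (Suc n)|"
  shows "|Col (omega n) (omega (Suc n)) :: ('a \<rightharpoonup> 'a) set| \<le>o |W (Suc n)|"
proof -
  define F where "F z = {p :: 'a \<rightharpoonup> 'a. Map.graph p \<subseteq> W n \<times> {..<z}}" for z
  have "|F z| \<le>o |W (Suc n)|" if "z < omega (Suc n)" for z
  proof -
    have "inj_on Map.graph (F z)"
    proof (rule inj_onI, rule ext)
      fix p q :: "'a \<rightharpoonup> 'a" and x assume "Map.graph p = Map.graph q"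
      then have "p x = Some y \<longleftrightarrow> q x = Some y" for y
        by (auto simp: Map.graph_def set_eq_iff)
      then show "p x = q x"
        by (metis option.exhaust)
    qed
    then have "|F z| \<le>o |Pow (W n \<times> {..<z})|"
      unfolding card_of_ordLeq[symmetric] F_def by blast
    also have "|W n \<times> {..<z}| \<le>o |W n|"
      using segment_less[OF that] less_Suc_iff infinite_W ordIso_imp_ordLeq[OF card_of_refl]
      by (intro card_of_Sigma_ordLeq_infinite) auto
    then have "|Pow (W n \<times> {..<z})| \<le>o |Pow (W n)|"
      by (rule card_of_Pow_mono_ordLeq)
    also note assms
    finally (ordLeq_transitive) show ?thesis .
  qed
  then have "|\<Union>z\<in>W (Suc n). F z| \<le>o |W (Suc n)|"
    by (intro UN_le ordIso_imp_ordLeq[OF card_of_refl]) simp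
  moreover have "Col (omega n) (omega (Suc n)) \<subseteq> (\<Union>z\<in>W (Suc n). F z)"
  proof
    fix p :: "'a \<rightharpoonup> 'a" assume p: "p \<in> Col (omega n) (omega (Suc n))"
    have "ran p = (\<lambda>x. the (p x)) ` dom p"
      by (force simp: ran_def)
    then have "|ran p| \<le>o |W n|"
      using p card_of_image[of "\<lambda>x. the (p x)" "dom p"] card_of_mono1[of "dom p" "W n"]
      unfolding Col_def by (metis (no_types, lifting) mem_Collect_eq ordLeq_transitive)
    then obtain z where "z < omega (Suc n)" "ran p \<subseteq> {..<z}"
      using bounded_in_Suc p unfolding Col_def by blast
    moreover have "Map.graph p \<subseteq> dom p \<times> ran p"
      by (auto simp: Map.graph_def ran_def)
    moreover have "dom p \<subseteq> W n"
      using p by (simp add: Col_def)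
    ultimately have "p \<in> F z"
      unfolding F_def by (auto dest!: subsetD)
    then show "p \<in> (\<Union>z\<in>W (Suc n). F z)"
      using \<open>z < omega (Suc n)\<close> by blast
  qed
  ultimately show ?thesis
    using card_of_mono1 ordLeq_transitive by blast
qed

lemma card_PiE:
  assumes "|A| \<le>o |W n|" "|B| \<le>o |W n|" "|Pow (W n)| \<le>o |W (Suc n)|"
  shows "|A \<rightarrow>\<^sub>E B| \<le>o |W (Suc n)|"
proof -
  have "inj_on (\<lambda>f. (\<lambda>x. (x, f x)) ` A) (A \<rightarrow>\<^sub>E B)"
  proof (rule inj_onI)
    fix f g assume fg: "f \<in> A \<rightarrow>\<^sub>E B" "g \<in> A \<rightarrow>\<^sub>E B" "(\<lambda>x. (x, f x)) ` A = (\<lambda>x. (x, g x)) ` A"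
    then have "f x = g x" if "x \<in> A" for x
      using that by blast
    then show "f = g"
      using fg by (intro PiE_ext) auto
  qed
  moreover have "(\<lambda>f. (\<lambda>x. (x, f x)) ` A) ` (A \<rightarrow>\<^sub>E B) \<subseteq> Pow (A \<times> B)"
    by auto
  ultimately have "|A \<rightarrow>\<^sub>E B| \<le>o |Pow (A \<times> B)|"
    unfolding card_of_ordLeq[symmetric] by blast
  also have "|A \<times> B| \<le>o |W n|"
    using assms infinite_W by (intro card_of_Sigma_ordLeq_infinite) auto
  then have "|Pow (A \<times> B)| \<le>o |Pow (W n)|"
    by (rule card_of_Pow_mono_ordLeq)
  also note assms(3)
  finally (ordLeq_transitive) show ?thesis .
qed

lemma Suc_le_of_less: "|W n| <o |A| \<Longrightarrow> |W (Suc n)| \<le>o |A|"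
  by (metis card_of_Well_order less_Suc_iff not_ordLess_iff_ordLeq not_ordLess_ordLeq)

text \<open>Downward induction from the diagonal case \<open>n = m\<close>. The two cardinality
  hypotheses of \<open>EH_colorable_Pow\<close> come from Cantor's theorem and
  \<open>gch\<close>.\<close>

lemma EH_lower:
  assumes gch: "\<And>n. |Pow (W n)| \<le>o |W (Suc n)|" and "n \<le> m"
  shows "\<nexists>c. vertex_coloring (EH (omega m) (omega n) :: ('a \<Rightarrow> 'a) graph) (W n) c"
  using assms(2)
proof (induction rule: inc_induct)
  case base
  then show ?case
    using EH_same_not_colorable[OF infinite_W segment_less] by blast
next
  case (step n)
  then show ?case
    using EH_colorable_Pow[OF infinite_W infinite_W Suc_le_of_less[OF card_of_Pow] gch] by blast
qed

text \<open>The induction carries more than a proper coloring: functions of equal color agree on a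
  positive set. Positivity is what \<open>ideal_transfer\<close> reflects from one cardinal to the
  next.\<close>

lemma EH_upper:
  assumes gch: "\<And>n. |Pow (W n)| \<le>o |W (Suc n)|"
    and G: "\<And>n. generic_family (omega n :: 'a) (omega (Suc n)) (I n) (g n)"
    and "n \<le> j"
  shows "\<exists>c. \<forall>f\<in>W (Suc j) \<rightarrow> W n. c f \<in> W (Suc n) \<and>
    (\<forall>f'\<in>W (Suc j) \<rightarrow> W n. c f = c f' \<longrightarrow> {\<gamma>. \<gamma> < omega (Suc j) \<and> f \<gamma> = f' \<gamma>} \<notin> I j)"
  using assms(3)
proof (induction rule: dec_induct)
  case base
  let ?P = "Col (omega n) (omega (Suc n)) :: ('a \<rightharpoonup> 'a) set" and ?c = "cylinder (omega (Suc n)) (g n)"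
  note I = generic_family_normal[OF G[of n]]
  have "|W n| \<le>o |W (Suc n)|"
    using W_mono[of n "Suc n"] by simp
  then have "|?P \<times> W n| \<le>o |W (Suc n)|"
    using card_Col[OF gch] infinite_W by (intro card_of_Sigma_ordLeq_infinite) auto
  then obtain k where k: "inj_on k (?P \<times> W n)" "k ` (?P \<times> W n) \<subseteq> W (Suc n)"
    unfolding card_of_ordLeq[symmetric] by blast
  \<comment> \<open>Some fiber of \<open>f\<close> is positive by completeness, and some cylinder is
    almost contained in it. The condition with the value is the color.\<close>
  have "\<exists>p i. p \<in> ?P \<and> i < omega n \<and> ?c p - {\<gamma>. f \<gamma> = i} \<in> I n" if f: "f \<in> W (Suc n) \<rightarrow> W n" for f
  proof -
    have "\<exists>i < omega n. {\<gamma>. \<gamma> < omega (Suc n) \<and> f \<gamma> = i} \<notin> I n"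
    proof (rule ccontr)
      assume "\<not> ?thesis"
      then have "(\<Union>i\<in>W n. {\<gamma>. \<gamma> < omega (Suc n) \<and> f \<gamma> = i}) \<in> I n"
        by (intro normal_ideal_UN[OF I W_less_Suc]) auto
      moreover have "W (Suc n) \<subseteq> (\<Union>i\<in>W n. {\<gamma>. \<gamma> < omega (Suc n) \<and> f \<gamma> = i})"
        using f by auto
      ultimately show False
        using normal_ideal_whole[OF I] normal_ideal_subset[OF I] by blast
    qed
    then obtain i where i: "i < omega n" "{\<gamma>. \<gamma> < omega (Suc n) \<and> f \<gamma> = i} \<notin> I n"
      by blast
    moreover have "{\<gamma>. \<gamma> < omega (Suc n) \<and> f \<gamma> = i} \<subseteq> W (Suc n)"
      by auto
    ultimately obtain p where p: "p \<in> ?P" "?c p - {\<gamma>. \<gamma> < omega (Suc n) \<and> f \<gamma> = i} \<in> I n"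
      using G[of n] unfolding generic_family_def by blast
    have "?c p - {\<gamma>. f \<gamma> = i} \<in> I n"
      by (rule normal_ideal_subset[OF I p(2)]) blast
    then show ?thesis
      using i(1) p(1) by blast
  qed
  then obtain p i where pi: "\<And>f. f \<in> W (Suc n) \<rightarrow> W n \<Longrightarrow>
      p f \<in> ?P \<and> i f < omega n \<and> ?c (p f) - {\<gamma>. f \<gamma> = i f} \<in> I n"
    by metis
  show ?case
  proof (intro exI[of _ "\<lambda>f. k (p f, i f)"] ballI conjI impI notI)
    show "k (p f, i f) \<in> W (Suc n)" if "f \<in> W (Suc n) \<rightarrow> W n" for f
      using k(2) pi[OF that] by (intro subsetD[OF k(2)] imageI) auto
  next
    fix f f'
    assume f: "f \<in> W (Suc n) \<rightarrow> W n" and f': "f' \<in> W (Suc n) \<rightarrow> W n"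
      and eq: "k (p f, i f) = k (p f', i f')"
      and A: "{\<gamma>. \<gamma> < omega (Suc n) \<and> f \<gamma> = f' \<gamma>} \<in> I n"
    have eq': "p f = p f'" "i f = i f'"
      using inj_onD[OF k(1) eq] pi[OF f] pi[OF f'] by auto
    have "(?c (p f) - {\<gamma>. f \<gamma> = i f}) \<union> ((?c (p f) - {\<gamma>. f' \<gamma> = i f}) \<union>
        {\<gamma>. \<gamma> < omega (Suc n) \<and> f \<gamma> = f' \<gamma>}) \<in> I n" (is "?U \<in> _")
      using pi[OF f] pi[OF f'] A eq' by (intro normal_ideal_Un[OF I]) auto
    then have "?c (p f) \<in> I n"
      by (rule normal_ideal_subset[OF I]) (auto simp: cylinder_def)
    then show False
      using generic_family_positive[OF G] pi[OF f] by blast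
  qed
next
  case (step j)
  let ?\<kappa> = "omega (Suc j) :: 'a" and ?\<mu> = "omega (Suc (Suc j)) :: 'a"
  obtain c where c: "\<And>f. f \<in> W (Suc j) \<rightarrow> W n \<Longrightarrow> c f \<in> W (Suc n)"
    "\<And>f f'. f \<in> W (Suc j) \<rightarrow> W n \<Longrightarrow> f' \<in> W (Suc j) \<rightarrow> W n \<Longrightarrow> c f = c f' \<Longrightarrow>
      {\<gamma>. \<gamma> < ?\<kappa> \<and> f \<gamma> = f' \<gamma>} \<notin> I j"
    using step.IH by blast
  have Q: "|Col ?\<kappa> ?\<mu>| \<le>o |W (Suc (Suc j))|"
    by (rule card_Col[OF gch])
  have T: "|W (Suc j) \<rightarrow>\<^sub>E Col ?\<kappa> ?\<mu>| \<le>o |W (Suc (Suc (Suc j)))|"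
    using W_mono[of "Suc j" "Suc (Suc j)"] by (intro card_PiE Q gch) simp
  have l: "|W n| \<le>o |W (Suc j)|"
    using step.hyps by (intro W_mono) simp
  \<comment> \<open>Three consecutive ideals enter: \<open>I j\<close> for the reduced power,
    \<open>I (Suc j)\<close> for the agreement sets and the next one for the generic chain.\<close>
  obtain \<Psi> where \<Psi>: "\<forall>f\<in>W (Suc (Suc j)) \<rightarrow> W n. \<Psi> f \<in> W (Suc j) \<rightarrow>\<^sub>E W n \<and>
      (\<forall>f'\<in>W (Suc (Suc j)) \<rightarrow> W n. {\<alpha>. \<alpha> < ?\<kappa> \<and> \<Psi> f \<alpha> = \<Psi> f' \<alpha>} \<notin> I j \<longrightarrow>
        {\<gamma>. \<gamma> < ?\<mu> \<and> f \<gamma> = f' \<gamma>} \<notin> I (Suc j))"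
    using ideal_transfer[OF generic_family_normal[OF G] G G Q T l] by blast
  have \<Psi>': "\<Psi> f \<in> W (Suc j) \<rightarrow> W n" if "f \<in> W (Suc (Suc j)) \<rightarrow> W n" for f
    using bspec[OF \<Psi> that] by (simp add: PiE_def)
  show ?case
  proof (intro exI[of _ "\<lambda>f. c (\<Psi> f)"] ballI conjI impI)
    fix f assume f: "f \<in> W (Suc (Suc j)) \<rightarrow> W n"
    show "c (\<Psi> f) \<in> W (Suc n)"
      by (rule c(1)[OF \<Psi>'[OF f]])
    fix f' assume f': "f' \<in> W (Suc (Suc j)) \<rightarrow> W n" and "c (\<Psi> f) = c (\<Psi> f')"
    then have "{\<alpha>. \<alpha> < ?\<kappa> \<and> \<Psi> f \<alpha> = \<Psi> f' \<alpha>} \<notin> I j"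
      by (intro c(2)[OF \<Psi>'[OF f] \<Psi>'])
    then show "{\<gamma>. \<gamma> < ?\<mu> \<and> f \<gamma> = f' \<gamma>} \<notin> I (Suc j)"
      using bspec[OF \<Psi> f] f' by blast
  qed
qed

lemma chromatic_number_EH:
  assumes gch: "\<And>n. |Pow (W n)| \<le>o |W (Suc n)|"
    and G: "\<And>n. generic_family (omega n :: 'a) (omega (Suc n)) (I n) (g n)"
    and "n \<le> m"
  shows "chromatic_number (EH (omega m :: 'a) (omega n)) =o |W (Suc n)|"
proof -
  let ?G = "EH (omega m :: 'a) (omega n)"
  let ?r = "chromatic_number ?G"
  have "\<exists>c. vertex_coloring ?G (W (Suc n)) c"
  proof (cases "m = n")
    case True
    have "|W n \<rightarrow>\<^sub>E W n| \<le>o |W (Suc n)|"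
      by (intro card_PiE gch ordIso_imp_ordLeq[OF card_of_refl])
    then obtain k where k: "inj_on k (W n \<rightarrow>\<^sub>E W n)" "k ` (W n \<rightarrow>\<^sub>E W n) \<subseteq> W (Suc n)"
      unfolding card_of_ordLeq[symmetric] by blast
    have "x \<noteq> y" if "{x, y} \<in> snd ?G" for x y
      using that EH_edges[of "omega m :: 'a" "omega n"] by auto
    then have "vertex_coloring ?G (W (Suc n)) k"
      unfolding vertex_coloring_def EH_vertices True
    proof (intro conjI ballI impI Pi_I)
      show "k f \<in> W (Suc n)" if "f \<in> W n \<rightarrow>\<^sub>E W n" for f
        using that by (intro subsetD[OF k(2)] imageI)
    qed (use inj_onD[OF k(1)] in metis)
    then show ?thesis
      by blast
  next
    case False
    then obtain j where j: "m = Suc j" "n \<le> j"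
      using \<open>n \<le> m\<close> by (cases m) auto
    obtain c where c: "\<And>f. f \<in> W m \<rightarrow> W n \<Longrightarrow> c f \<in> W (Suc n)"
      "\<And>f f'. f \<in> W m \<rightarrow> W n \<Longrightarrow> f' \<in> W m \<rightarrow> W n \<Longrightarrow> c f = c f' \<Longrightarrow>
        {\<gamma>. \<gamma> < omega m \<and> f \<gamma> = f' \<gamma>} \<notin> I j"
      using EH_upper[OF gch G j(2)] unfolding j(1) by blast
    have "c f \<noteq> c f'" if "{f, f'} \<in> snd ?G" for f f'
    proof
      assume eq: "c f = c f'"
      have "f \<in> W m \<rightarrow> W n" "f' \<in> W m \<rightarrow> W n"
        and small: "|{\<gamma>. \<gamma> < omega m \<and> f \<gamma> = f' \<gamma>}| <o |W m|"
        using that unfolding EH_edge_iff[OF infinite_W] by (auto simp: PiE_def)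
      then have "{\<gamma>. \<gamma> < omega m \<and> f \<gamma> = f' \<gamma>} \<notin> I j"
        using c(2) eq by blast
      \<comment> \<open>The ends of an edge agree on a set of smaller size, and such sets belong to
        the ideal.\<close>
      moreover have "{\<gamma>. \<gamma> < omega m \<and> f \<gamma> = f' \<gamma>} \<in> I j"
        using generic_family_normal[OF G[of j]] small unfolding j(1)
        by (intro normal_ideal_small) auto
      ultimately show False
        by blast
    qed
    then have "vertex_coloring ?G (W (Suc n)) c"
      using c(1) unfolding vertex_coloring_def EH_vertices by (auto simp: PiE_def)
    then show ?thesis
      by blast
  qed
  then have upper: "?r \<le>o |W (Suc n)|"
    using chromatic_number_le_iff[OF EH_edges card_of_Card_order] by (metis Field_card_of)
  have r: "Card_order ?r"
    by (rule chromatic_number(1)[OF EH_edges])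
  have "\<not> ?r \<le>o |W n|"
    using EH_lower[OF gch \<open>n \<le> m\<close>] chromatic_number_le_iff[OF EH_edges card_of_Card_order]
    by (metis Field_card_of)
  then have "\<not> |Field ?r| \<le>o |W n|"
    using card_of_Field_ordIso[OF r] ordIso_ordLeq_trans ordIso_symmetric by blast
  then have "|W (Suc n)| \<le>o |Field ?r|"
    by (intro Suc_le_of_less) (meson card_of_Well_order not_ordLeq_iff_ordLess)
  then have "|W (Suc n)| \<le>o ?r"
    using card_of_Field_ordIso[OF r] ordLeq_ordIso_trans by blast
  then show ?thesis
    using upper ordIso_iff_ordLeq by blast
qed

end

theorem theorem73:
  assumes "omegas_exist TYPE('a::wellorder)"
    and "\<forall>n. \<exists>I. normal_ideal_on (omega (Suc n) :: 'a) I \<and>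
           order_isomorphic (powerset_mod {..<omega (Suc n)} I)
             (boolean_completion (Col (omega n :: 'a) (omega (Suc n))) Col_le)"
  shows "\<forall>n m. n \<le> m \<longrightarrow>
           chromatic_number (EH (omega m :: 'a) (omega n)) =o |{..<omega (Suc n) :: 'a}|"
proof -
  interpret omegas "TYPE('a)"
    by standard (rule assms(1))
  have "\<exists>I g. generic_family (omega n :: 'a) (omega (Suc n)) I g" for n
  proof -
    obtain I where "normal_ideal_on (omega (Suc n) :: 'a) I"
      "order_isomorphic (powerset_mod {..<omega (Suc n)} I)
        (boolean_completion (Col (omega n :: 'a) (omega (Suc n))) Col_le)"
      using assms(2) by blast
    then show ?thesis
      using generic_family_exists[OF _ _ infinite_W ordLess_imp_ordLeq[OF W_less_Suc] segment_less]
      by blast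
  qed
  then obtain I g where G: "\<And>n. generic_family (omega n :: 'a) (omega (Suc n)) (I n) (g n)"
    by metis
  \<comment> \<open>The ideal used is two cardinals up, on \<open>omega (Suc (Suc n))\<close>, so
    that its collapse is closed under chains of length \<open>omega n\<close>.\<close>
  have "|Pow {..<omega n :: 'a}| \<le>o |{..<omega (Suc n) :: 'a}|" for n
    using Pow_le_of_generic_family[OF G] .
  then show ?thesis
    using chromatic_number_EH[OF _ G] by blast
qed

end
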